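(* Let $M,s\in\mathbb N$ with $M\ge2$, $\alpha>1/2$, $\boldsymbol\gamma=(\gamma_1,\gamma_2,\ldots)\in[0,1]^{\mathbb N}$ and $\tau\in(0,1)$. Then for any $1/2\le\lambda<\alpha$ and $0<\delta<1$, the root-mean-square error of the randomly shifted randomized rank-1 lattice rule $A_{M,\tau,\Delta}$ satisfies $$e^{\mathrm{rms}}(H_{s,\alpha,\boldsymbol\gamma},A_{M,\tau,\Delta})\le\left(\frac{c'}{\delta\tau M}\right)^{1/2}\left(\frac{2}{(1-\tau)M}\sum_{\emptyset\ne u\subseteq\{1,\ldots,s\}}\gamma_u^{1/\lambda}\bigl(2\zeta(\alpha/\lambda)\bigr)^{|u|}\right)^{\lambda(1-\delta/(2\alpha))},$$ with some constant $c'>0$ independent of $s$, $M$ and $\tau$. Thus the root-mean-square error decays at the rate of $1/M^{1/2+\lambda(1-\delta/(2\alpha))}$, where the exponent is arbitrarily close to $\alpha+1/2$ when $\lambda\to\alpha$ and $\delta\to0$. Moreover, the error is bounded independently of the dimension $s$ if there exists $1/2\le\lambda<\alpha$ such that $\sum_{j=1}^\infty\gamma_j^{1/\lambda}<\infty$ (using the bound above with this $\lambda$).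
   Context: Notation: $\mathbb N=\{1,2,\ldots\}$; $\zeta$ is the Riemann zeta function; $\gamma_u=\prod_{j\in u}\gamma_j$. $I(f)=\int_{[0,1)^s}f(\boldsymbol x)\,d\boldsymbol x$, and for a finite point (multi)set $P$ with $N$ elements, $I(f;P)=\frac1N\sum_{\boldsymbol x\in P}f(\boldsymbol x)$. Weighted Korobov space. For $\boldsymbol k\in\mathbb Z^{\ell}$ put $r_{\alpha,\boldsymbol\gamma}(\boldsymbol k)=\prod_{j:\,k_j\ne0}|k_j|^\alpha/\gamma_j$ (empty product $=1$; if $k_j\neq 0$ and $\gamma_j=0$ for some $j$, then $1/r_{\alpha,\boldsymbol\gamma}(\boldsymbol k)=0$). $H_{s,\alpha,\boldsymbol\gamma}$ is the space of functions $f:[0,1)^s\to\mathbb R$ (one-periodic in each variable) with absolutely convergent Fourier series $f(\boldsymbol x)=\sum_{\boldsymbol k\in\mathbb Z^s}\hat f(\boldsymbol k)e^{2\pi i\boldsymbol k\cdot\boldsymbol x}$ and finite norm $\|f\|_{s,\alpha,\boldsymbol\gamma}=\bigl(\sum_{\boldsymbol k\in\mathbb Z^s}r_{\alpha,\boldsymbol\gamma}(\boldsymbol k)^2|\hat f(\boldsymbol k)|^2\bigr)^{1/2}$; if $\gamma_j=0$, it is required that $\hat f(\boldsymbol k)=0$ whenever $k_j\ne0$ (and such terms contribute $0$ to the norm). Lattice rules. For $N\ge2$ and $\boldsymbol z\in\{1,\ldots,N-1\}^{\ell}$, the rank-1 lattice point set is $P_{N,\boldsymbol z}=\{\{n\boldsymbol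 z/N\}:n=0,\ldots,N-1\}$ (componentwise fractional parts); for $\Delta\in[0,1)^s$ the shifted point set is $P_{N,\boldsymbol z}+\Delta=\{\{n\boldsymbol z/N+\Delta\}:n=0,\ldots,N-1\}$. The dual lattice is $P_{N,\boldsymbol z}^\perp=\{\boldsymbol k\in\mathbb Z^{\ell}:\boldsymbol k\cdot\boldsymbol z\equiv0\pmod N\}$. Let $R_{\alpha,\boldsymbol\gamma}(\boldsymbol z)=\sum_{\boldsymbol k\in P_{N,\boldsymbol z}^\perp\setminus\{\boldsymbol 0\}}r_{\alpha,\boldsymbol\gamma}(\boldsymbol k)^{-2}$. Randomized component-by-component algorithm. Let $\mathbb P_M=\{N \text{ prime}:\lceil M/2\rceil<N\le M\}$. (1) Pick $N\in\mathbb P_M$ uniformly at random. (2) Set $z_1=1$. (3) For $\ell=2,\ldots,s$, given $\boldsymbol z_{\ell-1}=(z_1,\ldots,z_{\ell-1})$, let $Z_\ell\subset\{1,\ldots,N-1\}$ consist of the $\lceil\tau(N-1)\rceil$ elements $\zeta$ with the smallest values of $R_{\alpha,\boldsymbol\gamma}(\boldsymbol z_{\ell-1},\zeta)$ (ties broken in favour of the smaller integer), and pick $z_\ell\in Z_\ell$ uniformly at random. For $N\in\mathbb P_M$, $\mathcal Z_{N,\tau}\subseteq\{1,\ldots,N-1\}^s$ denotes the set of all vectors $\boldsymbol z=(z_1,\ldots,z_s)$ that steps (2)–(3) can produce. The randomized algorithm is $A_{M,\tau,\Delta}(f)=I(f;P_{N,\boldsymbol z}+\Delta)$ with $N$ uniform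 in $\mathbb P_M$, $\boldsymbol z$ uniform in $\mathcal Z_{N,\tau}$ and $\Delta$ uniform in $[0,1)^s$, and $$e^{\mathrm{rms}}(H_{s,\alpha,\boldsymbol\gamma},A_{M,\tau,\Delta})=\sup_{\|f\|_{s,\alpha,\boldsymbol\gamma}\le1}\left(\frac1{|\mathbb P_M|}\sum_{N\in\mathbb P_M}\frac1{|\mathcal Z_{N,\tau}|}\sum_{\boldsymbol z\in\mathcal Z_{N,\tau}}\int_{[0,1)^s}|I(f;P_{N,\boldsymbol z}+\Delta)-I(f)|^2\,d\Delta\right)^{1/2}.$$ *)

theory Defs
  imports "HOL-Analysis.Analysis" "HOL-Number_Theory.Cong" "HOL-Computational_Algebra.Primes"
begin

text \<open>The dimension \<open>s\<close> varies inside the statement, so vectors indexed by \<open>1, \<dots>, s\<close> are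
  extensional functions on \<^term>\<open>{1..s}\<close>. Weights are indexed from \<open>1\<close>; the value
  \<open>\<gamma> 0\<close> is never used.\<close>

definition cube :: "nat \<Rightarrow> (nat \<Rightarrow> real) set" where
  "cube s = ({1..s} \<rightarrow>\<^sub>E {0..<1})"

definition lborel_dim :: "nat \<Rightarrow> (nat \<Rightarrow> real) measure" where
  "lborel_dim s = (\<Pi>\<^sub>M j\<in>{1..s}. lborel)"

definition int_vecs :: "nat \<Rightarrow> (nat \<Rightarrow> int) set" where
  "int_vecs s = ({1..s} \<rightarrow>\<^sub>E UNIV)"

text \<open>Real arguments \<open>x > 1\<close> only.\<close>

definition riemann_zeta :: "real \<Rightarrow> real" where
  "riemann_zeta x = (\<Sum>n. 1 / real (Suc n) powr x)"

text \<open>If \<open>k j \<noteq> 0\<close> and \<open>\<gamma> j = 0\<close> for some \<open>j\<close>, then \<open>r_weight\<close> takes the value \<open>0\<close>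
  because \<open>x / 0 = 0\<close>. Hence \<open>1 / r_weight\<close> is \<open>0\<close> as well, and such frequencies contribute \<open>0\<close>
  to the Korobov norm, as the convention for vanishing weights demands.\<close>

definition r_weight :: "nat \<Rightarrow> real \<Rightarrow> (nat \<Rightarrow> real) \<Rightarrow> (nat \<Rightarrow> int) \<Rightarrow> real" where
  "r_weight s \<alpha> \<gamma> k = (\<Prod>j\<in>{j\<in>{1..s}. k j \<noteq> 0}. \<bar>real_of_int (k j)\<bar> powr \<alpha> / \<gamma> j)"

definition fourier_char :: "nat \<Rightarrow> (nat \<Rightarrow> int) \<Rightarrow> (nat \<Rightarrow> real) \<Rightarrow> complex" where
  "fourier_char s k x = cis (2 * pi * (\<Sum>j\<in>{1..s}. real_of_int (k j) * x j))"

definition fourier_coeff :: "nat \<Rightarrow> ((nat \<Rightarrow> real) \<Rightarrow> real) \<Rightarrow> (nat \<Rightarrow> int) \<Rightarrow> complex" where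
  "fourier_coeff s f k =
     (LINT x:cube s|lborel_dim s. complex_of_real (f x) * cnj (fourier_char s k x))"

text \<open>Only the values of \<open>f\<close> on \<^term>\<open>cube s\<close> matter; periodicity means that \<open>f\<close> is evaluated
  at fractional parts.\<close>

definition korobov_space :: "nat \<Rightarrow> real \<Rightarrow> (nat \<Rightarrow> real) \<Rightarrow> ((nat \<Rightarrow> real) \<Rightarrow> real) set" where
  "korobov_space s \<alpha> \<gamma> = {f.
     (\<lambda>k. norm (fourier_coeff s f k)) summable_on int_vecs s \<and>
     (\<forall>x\<in>cube s. complex_of_real (f x) =
        (\<Sum>\<^sub>\<infinity>k\<in>int_vecs s. fourier_coeff s f k * fourier_char s k x)) \<and>
     (\<lambda>k. (r_weight s \<alpha> \<gamma> k)\<^sup>2 * (norm (fourier_coeff s f k))\<^sup>2) summable_on int_vecs s \<and>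
     (\<forall>k\<in>int_vecs s. (\<exists>j\<in>{1..s}. \<gamma> j = 0 \<and> k j \<noteq> 0) \<longrightarrow> fourier_coeff s f k = 0)}"

definition korobov_norm :: "nat \<Rightarrow> real \<Rightarrow> (nat \<Rightarrow> real) \<Rightarrow> ((nat \<Rightarrow> real) \<Rightarrow> real) \<Rightarrow> real" where
  "korobov_norm s \<alpha> \<gamma> f =
     sqrt (\<Sum>\<^sub>\<infinity>k\<in>int_vecs s. (r_weight s \<alpha> \<gamma> k)\<^sup>2 * (norm (fourier_coeff s f k))\<^sup>2)"

definition shifted_lattice_point ::
    "nat \<Rightarrow> nat \<Rightarrow> (nat \<Rightarrow> nat) \<Rightarrow> (nat \<Rightarrow> real) \<Rightarrow> nat \<Rightarrow> nat \<Rightarrow> real" where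
  "shifted_lattice_point s N z \<Delta> n = (\<lambda>j\<in>{1..s}. frac (real n * real (z j) / real N + \<Delta> j))"

definition shifted_lattice_rule ::
    "nat \<Rightarrow> nat \<Rightarrow> (nat \<Rightarrow> nat) \<Rightarrow> (nat \<Rightarrow> real) \<Rightarrow> ((nat \<Rightarrow> real) \<Rightarrow> real) \<Rightarrow> real" where
  "shifted_lattice_rule s N z \<Delta> f = (\<Sum>n<N. f (shifted_lattice_point s N z \<Delta> n)) / real N"

definition dual_lattice :: "nat \<Rightarrow> nat \<Rightarrow> (nat \<Rightarrow> nat) \<Rightarrow> (nat \<Rightarrow> int) set" where
  "dual_lattice l N z = {k \<in> int_vecs l. [(\<Sum>j\<in>{1..l}. k j * int (z j)) = 0] (mod int N)}"

definition R_crit :: "nat \<Rightarrow> real \<Rightarrow> (nat \<Rightarrow> real) \<Rightarrow> nat \<Rightarrow> (nat \<Rightarrow> nat) \<Rightarrow> real" where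
  "R_crit l \<alpha> \<gamma> N z =
     (\<Sum>\<^sub>\<infinity>k\<in>dual_lattice l N z - {\<lambda>j\<in>{1..l}. 0}. 1 / (r_weight l \<alpha> \<gamma> k)\<^sup>2)"

definition prime_range :: "nat \<Rightarrow> nat set" where
  "prime_range M = {N. prime N \<and> \<lceil>real M / 2\<rceil> < int N \<and> N \<le> M}"

text \<open>\<^const>\<open>sort_key\<close> is stable, so ties are broken in favour of the smaller integer. Only the
  entries of \<open>z\<close> with index below \<open>l\<close> are used.\<close>

definition cbc_candidates ::
    "real \<Rightarrow> (nat \<Rightarrow> real) \<Rightarrow> nat \<Rightarrow> real \<Rightarrow> nat \<Rightarrow> (nat \<Rightarrow> nat) \<Rightarrow> nat set" where
  "cbc_candidates \<alpha> \<gamma> N \<tau> l z =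
     set (take (nat \<lceil>\<tau> * (real N - 1)\<rceil>) (sort_key (\<lambda>\<zeta>. R_crit l \<alpha> \<gamma> N (z(l := \<zeta>))) [1..<N]))"

definition cbc_vectors ::
    "nat \<Rightarrow> real \<Rightarrow> (nat \<Rightarrow> real) \<Rightarrow> nat \<Rightarrow> real \<Rightarrow> (nat \<Rightarrow> nat) set" where
  "cbc_vectors s \<alpha> \<gamma> N \<tau> =
     {z \<in> {1..s} \<rightarrow>\<^sub>E {1..N - 1}. z 1 = 1 \<and> (\<forall>l\<in>{2..s}. z l \<in> cbc_candidates \<alpha> \<gamma> N \<tau> l z)}"

text \<open>The supremum is taken in the extended reals, so that it is meaningful without a prior
  boundedness proof.\<close>

definition rms_error :: "nat \<Rightarrow> real \<Rightarrow> (nat \<Rightarrow> real) \<Rightarrow> nat \<Rightarrow> real \<Rightarrow> ereal" where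
  "rms_error s \<alpha> \<gamma> M \<tau> =
     (SUP f\<in>{f \<in> korobov_space s \<alpha> \<gamma>. korobov_norm s \<alpha> \<gamma> f \<le> 1}.
        ereal (sqrt (1 / real (card (prime_range M)) *
          (\<Sum>N\<in>prime_range M. 1 / real (card (cbc_vectors s \<alpha> \<gamma> N \<tau>)) *
            (\<Sum>z\<in>cbc_vectors s \<alpha> \<gamma> N \<tau>.
               LINT \<Delta>:cube s|lborel_dim s.
                 \<bar>shifted_lattice_rule s N z \<Delta> f - (LINT x:cube s|lborel_dim s. f x)\<bar>\<^sup>2)))))"

end

(*
  Averaging over the shift turns the squared error of the lattice rule (N, z) into the sum of
  |f^(k)|^2 over the nonzero k in its dual lattice. Averaging over N and z as well leaves
  the sum over all k of |f^(k)|^2 p(k), where p(k) is the probability that k lies in the random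
  dual lattice, so the squared error is at most the supremum of p(k) / r(k)^2.

  Two bounds on this quotient are interpolated. First, if p(k) > 0, then 1 / r(k)^2 is a term of
  R(z) for some admissible z, and the component-by-component construction forces
  R(z) <= B^(2 lam), where B is the base of the power in the theorem: at least (1 - tau) (N - 1)
  of the N - 1 candidates for z_l are no better than the one chosen, so its contribution is at
  most 1 / (1 - tau) times the average, which Jensen's inequality with exponent 1 / (2 lam)
  bounds. Secondly, if N does not divide some k_j, then at most a fraction 1 / (tau (N - 1)) of
  the vectors z satisfies k.z = 0 mod N, while the proportion of primes N in (M/2, M] dividing
  k_j is O(|k_j|^delta / M), because there are at least M^(1 - eps) such primes once M is large.
  The factor |k_j|^delta is absorbed by a power of 1 / r(k)^2.
*)
theory Submission
  imports Defs "HOL-Real_Asymp.Real_Asymp"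
begin

section \<open>Primes in the upper half of an interval\<close>

text \<open>The delicate case is a modulus N dividing every coordinate of k: then k lies in the dual
  lattice for all z, so such moduli must be rare. At most log_2 |k_j| primes divide k_j, to be
  compared with about M^(1 - eps) moduli. The loss M^eps is affordable since a modulus N > M/2
  dividing k_j forces M <= 2 |k_j|, so a further power of |k_j| pays for it. An Erdos-type count of
  the primes in (n, 2n] is therefore strong enough. The interpolation writes w = 1/r(k)^2 as w^(1 -
  t) w^t with t = \<delta>/(2 \<alpha>). As the weights are at most 1, w <= |k_j|^(-2 \<alpha>), so
  w^t cancels exactly the growth |k_j|^\<delta> of p(k), while w^(1 - t) <= B^(2 lam (1 - t)); the
  square root gives the exponent of the theorem. The range of lam has two reasons: 1/2 <= lam makes
  the Jensen exponent 1/(2 lam) at most 1, and lam < \<alpha> makes the zeta argument \<alpha>/lam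
  exceed 1. The coordinatewise bounds telescope to the product of all 1 + 2 \<gamma>_j^(1/lam)
  zeta(\<alpha>/lam), minus 1, which expands into the sum over nonempty u.\<close>

lemma multiplicity_eq_card_powers:
  fixes p m :: nat
  assumes "prime p" "0 < m" "m < p ^ K"
  shows "multiplicity p m = card {i\<in>{1..K}. p ^ i dvd m}"
proof -
  have p1: "p > 1" using assms prime_gt_1_nat by blast
  have "p ^ multiplicity p m \<le> m" using assms by (intro dvd_imp_le multiplicity_dvd) auto
  hence "p ^ multiplicity p m < p ^ K" using assms by simp
  hence "multiplicity p m < K" using p1 by (simp add: power_strict_increasing_iff)
  hence "{i\<in>{1..K}. p ^ i dvd m} = {1..multiplicity p m}"
    using assms p1 by (auto simp: power_dvd_iff_le_multiplicity)
  thus ?thesis by simp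
qed

text \<open>Passing from \<open>n\<close> to \<open>n + 1\<close> raises \<open>n div p ^ i\<close>
  exactly for those \<open>i\<close> with \<open>p ^ i\<close> dividing \<open>n + 1\<close>, and
  the number of these is the multiplicity of \<open>p\<close> in the new factor. The cutoff
  \<open>K\<close> only drops zero terms.\<close>

lemma legendre_formula:
  fixes p n :: nat
  assumes "prime p" "n < p ^ K"
  shows "multiplicity p (fact n :: nat) = (\<Sum>i\<in>{1..K}. n div p ^ i)"
  using assms(2)
proof (induction n)
  case 0
  show ?case by simp
next
  case (Suc n)
  have pe: "prime_elem p" using assms by auto
  have "multiplicity p (fact (Suc n) :: nat) = multiplicity p (Suc n) + multiplicity p (fact n :: nat)"
    unfolding fact_Suc of_nat_id
    using pe by (subst prime_elem_multiplicity_mult_distrib) auto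
  also have "multiplicity p (Suc n) = (\<Sum>i\<in>{1..K}. if p ^ i dvd Suc n then 1 else 0)"
    by (subst multiplicity_eq_card_powers[OF assms(1) _ Suc.prems])
       (simp_all flip: sum.inter_filter)
  also have "multiplicity p (fact n :: nat) = (\<Sum>i\<in>{1..K}. n div p ^ i)"
    using Suc by simp
  also have "(\<Sum>i\<in>{1..K}. if p ^ i dvd Suc n then 1 else 0) + (\<Sum>i\<in>{1..K}. n div p ^ i)
      = (\<Sum>i\<in>{1..K}. Suc n div p ^ i)"
    unfolding sum.distrib[symmetric] by (intro sum.cong) (auto simp: div_Suc dvd_eq_mod_eq_0)
  finally show ?case .
qed

lemma multiplicity_central_binomial:
  fixes p n :: nat
  assumes "prime p" "2 * n < p ^ K"
  shows "multiplicity p ((2 * n) choose n) = (\<Sum>i\<in>{1..K}. (2 * n) div p ^ i - 2 * (n div p ^ i))"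
proof -
  have pe: "prime_elem p" using assms by auto
  have "fact n * fact n * ((2 * n) choose n) = (fact (2 * n) :: nat)"
    using binomial_fact_lemma[of n "2 * n"] by simp
  hence "multiplicity p (fact (2 * n) :: nat) = multiplicity p (fact n * fact n * ((2 * n) choose n) :: nat)"
    by simp
  also have "\<dots> = 2 * multiplicity p (fact n :: nat) + multiplicity p ((2 * n) choose n)"
    using pe by (simp add: prime_elem_multiplicity_mult_distrib)
  finally have "(\<Sum>i\<in>{1..K}. (2 * n) div p ^ i) = 2 * (\<Sum>i\<in>{1..K}. n div p ^ i) + multiplicity p ((2 * n) choose n)"
    using assms legendre_formula[of p "2 * n" K] legendre_formula[of p n K] by simp
  moreover have "(\<Sum>i\<in>{1..K}. (2 * n) div p ^ i - 2 * (n div p ^ i)) =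
      (\<Sum>i\<in>{1..K}. (2 * n) div p ^ i) - (\<Sum>i\<in>{1..K}. 2 * (n div p ^ i))"
  \<comment> \<open>Subtraction on naturals splits over the sum because no term is
    truncated.\<close>
  proof (rule sum_subtractf_nat)
    fix i show "2 * (n div p ^ i) \<le> 2 * n div p ^ i"
      by (cases "p ^ i = 0") (simp_all add: less_eq_div_iff_mult_less_eq del: power_eq_0_iff)
  qed
  ultimately show ?thesis by (simp add: sum_distrib_left)
qed

text \<open>The familiar fact that floor (2x) - 2 floor x is 0 or 1, for x = n/d.\<close>

lemma double_div_diff_le_1: "(2 * n) div d - 2 * (n div d) \<le> (1::nat)"
proof (cases "d = 0")
  case False
  have "n < d * Suc (n div d)" using False by (simp add: dividend_less_times_div)
  hence "2 * n < d * (2 * (n div d) + 2)" by (simp add: algebra_simps)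
  hence "(2 * n) div d < 2 * (n div d) + 2"
    using False by (simp add: less_mult_imp_div_less mult.commute)
  thus ?thesis by simp
qed simp

text \<open>The Legendre sum is cut at \<open>v\<close>, the multiplicity itself. If
  \<open>p ^ v\<close> exceeded \<open>2 * n\<close>, the last term would vanish and the other
  \<open>v - 1\<close> terms, each at most 1, could not add up to \<open>v\<close>.\<close>

lemma prime_power_multiplicity_central_binomial_le:
  fixes p n :: nat
  assumes "prime p" "n > 0"
  shows "p ^ multiplicity p ((2 * n) choose n) \<le> 2 * n"
proof (rule ccontr)
  define v where "v = multiplicity p ((2 * n) choose n)"
  assume "\<not> ?thesis"
  hence v: "2 * n < p ^ v" by (simp add: v_def)
  have v0: "v > 0" using v assms by (cases v) auto
  then obtain u where u: "v = Suc u" by (cases v) auto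
  have "v = (\<Sum>i\<in>{1..v}. (2 * n) div p ^ i - 2 * (n div p ^ i))"
    unfolding v_def using assms v by (intro multiplicity_central_binomial) (auto simp: v_def)
  also have "\<dots> = (\<Sum>i\<in>{1..u}. (2 * n) div p ^ i - 2 * (n div p ^ i))"
    using v by (simp add: u del: power_Suc)
  also have "\<dots> \<le> (\<Sum>i\<in>{1..u}. 1)" by (intro sum_mono double_div_diff_le_1)
  also have "\<dots> = u" by simp
  finally show False using u by simp
qed

lemma multiplicity_central_binomial_le_1:
  fixes p n :: nat
  assumes "prime p" "2 * n < p ^ 2"
  shows "multiplicity p ((2 * n) choose n) \<le> 1"
proof -
  have "multiplicity p ((2 * n) choose n) = (\<Sum>i\<in>{1..2}. (2 * n) div p ^ i - 2 * (n div p ^ i))"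
    by (rule multiplicity_central_binomial[OF assms])
  also have "{1..2} = {1, 2::nat}" by auto
  also have "(\<Sum>i\<in>{1, 2::nat}. (2 * n) div p ^ i - 2 * (n div p ^ i)) = (2 * n) div p - 2 * (n div p)"
    using assms by simp
  also have "\<dots> \<le> 1" by (rule double_div_diff_le_1)
  finally show ?thesis .
qed

text \<open>For p in (2n/3, n] the quotients are 2 and 1, so the only Legendre term that could
  survive is 2 - 2 * 1. The absence of these primes is what later wins a fixed power of 4.\<close>

lemma multiplicity_central_binomial_eq_0:
  fixes p n :: nat
  assumes "prime p" "2 * n < p ^ 2" "2 * n < 3 * p" "p \<le> n"
  shows "multiplicity p ((2 * n) choose n) = 0"
proof -
  have "multiplicity p ((2 * n) choose n) = (\<Sum>i\<in>{1..2}. (2 * n) div p ^ i - 2 * (n div p ^ i))"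
    by (rule multiplicity_central_binomial[OF assms(1,2)])
  also have "{1..2} = {1, 2::nat}" by auto
  also have "(\<Sum>i\<in>{1, 2::nat}. (2 * n) div p ^ i - 2 * (n div p ^ i)) = (2 * n) div p - 2 * (n div p)"
    using assms by simp
  also have "(2 * n) div p = 2" using assms by (intro div_nat_eqI) auto
  also have "n div p = 1" using assms by (intro div_nat_eqI) auto
  finally show ?thesis by simp
qed

text \<open>Row 2m + 1 has two equal middle entries, so twice either of them is at most 2^(2m +
  1).\<close>

lemma binomial_odd_middle_le: "(2 * m + 1) choose m \<le> 4 ^ m"
proof -
  have "2 * ((2 * m + 1) choose m) = (\<Sum>k\<in>{m, Suc m}. (2 * m + 1) choose k)"
    using binomial_symmetric[of m "2 * m + 1"] by simp
  also have "\<dots> \<le> (\<Sum>k\<le>2 * m + 1. (2 * m + 1) choose k)"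
    by (intro sum_mono2) auto
  also have "\<dots> = 2 * 4 ^ m"
    by (subst choose_row_sum) (simp add: power_mult)
  finally show ?thesis by simp
qed

lemma prod_primes_dvd:
  fixes n :: nat
  assumes "finite A" "\<And>p. p \<in> A \<Longrightarrow> prime p" "\<And>p. p \<in> A \<Longrightarrow> p dvd n"
  shows "\<Prod>A dvd n"
  using assms
proof (induction A rule: finite_induct)
  case (insert p A)
  have "coprime p (\<Prod>A)"
    using insert by (intro prod_coprime_right) (metis insertCI primes_coprime)
  thus ?case using insert by (simp add: divides_mult)
qed simp

text \<open>Erdos' induction. For odd n = 2m + 1 the primes in (m + 1, 2m + 1] all divide
  \<open>(2 * m + 1) choose m\<close>, so their product is at most 4^m, while those up to m + 1 are
  covered by the induction hypothesis. An even n > 2 is not prime and adds nothing.\<close>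

lemma primorial_le: "\<Prod>{p. prime p \<and> p \<le> n} \<le> (4 ^ n :: nat)"
proof (induction n rule: less_induct)
  case (less n)
  consider "n \<le> 1" | "n = 2" | "n > 2" "even n" | "n > 2" "odd n" by linarith
  thus ?case
  proof cases
    case 1
    hence "\<not> (prime p \<and> p \<le> n)" for p using prime_ge_2_nat[of p] by auto
    hence "{p. prime p \<and> p \<le> n} = {}" by blast
    thus ?thesis by (simp only: prod.empty) simp
  next
    case 2
    hence "prime p \<and> p \<le> n \<longleftrightarrow> p = 2" for p using prime_ge_2_nat[of p] by auto
    hence "{p. prime p \<and> p \<le> n} = {2}" by blast
    thus ?thesis using 2 by simp
  next
    case 3
    hence "\<not> prime n" using prime_odd_nat by blast
    hence "prime p \<and> p \<le> n \<longleftrightarrow> prime p \<and> p \<le> n - 1" for p by (cases "p = n") auto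
    hence "{p. prime p \<and> p \<le> n} = {p. prime p \<and> p \<le> n - 1}" by blast
    hence "\<Prod>{p. prime p \<and> p \<le> n} \<le> 4 ^ (n - 1)" using less[of "n - 1"] 3 by simp
    also have "\<dots> \<le> (4 ^ n :: nat)" by (intro power_increasing) auto
    finally show ?thesis .
  next
    case 4
    then obtain m where m: "n = 2 * m + 1" by (elim oddE)
    hence m1: "m \<ge> 1" using 4 by simp
    let ?A = "{p. prime p \<and> p \<le> m + 1}" and ?B = "{p. prime p \<and> m + 1 < p \<and> p \<le> 2 * m + 1}"
    have fin: "finite ?A" "finite ?B" by auto
    have "{p. prime p \<and> p \<le> n} = ?A \<union> ?B" using m by auto
    hence "\<Prod>{p. prime p \<and> p \<le> n} = \<Prod>?A * \<Prod>?B"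
      using fin by (simp add: prod.union_disjoint disjoint_iff)
    moreover have "\<Prod>?A \<le> 4 ^ (m + 1)" using less[of "m + 1"] m m1 by simp
    moreover have "\<Prod>?B \<le> 4 ^ m"
    proof -
      have "\<Prod>?B dvd ((2 * m + 1) choose m)"
      proof (rule prod_primes_dvd)
        fix p assume p: "p \<in> ?B"
        have "fact m * fact (m + 1) * ((2 * m + 1) choose m) = (fact (2 * m + 1) :: nat)"
          using binomial_fact_lemma[of m "2 * m + 1"] by simp
        moreover have "p dvd (fact (2 * m + 1) :: nat)" using p by (subst prime_dvd_fact_iff) auto
        moreover have "\<not> p dvd (fact m :: nat)" "\<not> p dvd (fact (m + 1) :: nat)"
          using p by (subst prime_dvd_fact_iff; simp)+
        ultimately show "p dvd ((2 * m + 1) choose m)"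
          using p by (metis (no_types, lifting) mem_Collect_eq prime_dvd_mult_iff)
      qed (use fin in auto)
      hence "\<Prod>?B \<le> (2 * m + 1) choose m" by (intro dvd_imp_le) auto
      also have "\<dots> \<le> 4 ^ m" by (rule binomial_odd_middle_le)
      finally show ?thesis .
    qed
    ultimately have "\<Prod>{p. prime p \<and> p \<le> n} \<le> 4 ^ (m + 1) * 4 ^ m" by (simp only: mult_le_mono)
    also have "\<dots> = (4 ^ n :: nat)" unfolding m by (subst power_add[symmetric]) simp
    finally show ?thesis .
  qed
qed

text \<open>As in Erdos' proof of Bertrand's postulate, primes in \<open>(2n/3, n]\<close> do not divide the
  central binomial coefficient and those above \<open>sqrt (2n)\<close> divide it at most once.\<close>

lemma central_binomial_le_prime_products:
  fixes n :: nat
  assumes "n > 0"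
  shows "(2 * n) choose n \<le> (2 * n) ^ card {p. prime p \<and> p ^ 2 \<le> 2 * n} * 4 ^ (2 * n div 3)
           * (2 * n) ^ card {p. prime p \<and> n < p \<and> p \<le> 2 * n}"
proof -
  let ?C = "(2 * n) choose n"
  let ?P = "{p. prime p \<and> p \<le> 2 * n}"
  let ?A1 = "{p. prime p \<and> p ^ 2 \<le> 2 * n}" and ?A2 = "{p. prime p \<and> p \<le> 2 * n div 3}"
    and ?A3 = "{p. prime p \<and> n < p \<and> p \<le> 2 * n}"
  have C0: "?C > 0" by simp
  have fP: "finite ?P" by auto
  have sub: "prime_factors ?C \<subseteq> ?P"
  proof
    fix p assume "p \<in> prime_factors ?C"
    hence p: "prime p" "p dvd ?C" by auto
    have "?C dvd fact (2 * n)" using binomial_fact_lemma[of n "2 * n"] by (metis dvd_triv_right le_add2 mult_2)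
    hence "p \<le> 2 * n" using p prime_dvd_fact_iff dvd_trans by blast
    thus "p \<in> ?P" using p by simp
  qed
  have "?C = (\<Prod>p\<in>prime_factors ?C. p ^ multiplicity p ?C)"
    by (rule prime_factorization_nat) simp
  also have "\<dots> = (\<Prod>p\<in>?P. p ^ multiplicity p ?C)"
    using sub fP by (intro prod.mono_neutral_left) (auto simp: prime_factors_multiplicity)
  \<comment> \<open>One factor per range of p: at most sqrt (2n), at most 2n/3, above n. The ranges
    overlap, which is harmless because every factor is at least 1; primes in none of them have
    multiplicity 0.\<close>
  also have "\<dots> \<le> (\<Prod>p\<in>?P. (if p ^ 2 \<le> 2 * n then 2 * n else 1) * (if p \<le> 2 * n div 3 then p else 1)
      * (if n < p then 2 * n else 1))"
  proof (rule prod_mono, safe)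
    fix p :: nat assume p: "prime p" "p \<le> 2 * n"
    have p0: "p > 0" using p prime_gt_0_nat by blast
    show "p ^ multiplicity p ?C \<le> (if p ^ 2 \<le> 2 * n then 2 * n else 1) * (if p \<le> 2 * n div 3 then p else 1)
      * (if n < p then 2 * n else 1)"
    proof (cases "p ^ 2 \<le> 2 * n")
      case True
      have "p ^ multiplicity p ?C \<le> 2 * n"
        by (rule prime_power_multiplicity_central_binomial_le) (use p assms in auto)
      also have "\<dots> * 1 * 1 \<le> 2 * n * (if p \<le> 2 * n div 3 then p else 1) * (if n < p then 2 * n else 1)"
        using p0 assms by (intro mult_le_mono) auto
      finally show ?thesis using True by simp
    next
      case False
      hence sq: "2 * n < p ^ 2" by simp
      from multiplicity_central_binomial_le_1[OF p(1) sq]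
      have le: "p ^ multiplicity p ?C \<le> p ^ 1" using p0 by (intro power_increasing) auto
      show ?thesis
      proof (cases "p \<le> 2 * n div 3 \<or> n < p")
        case True
        hence "p \<le> (if p \<le> 2 * n div 3 then p else 1) * (if n < p then 2 * n else 1)"
          using p by (cases "p \<le> 2 * n div 3") auto
        thus ?thesis using False le by simp
      next
        case F2: False
        hence "2 * n < 3 * p" "p \<le> n" by (auto simp: not_le div_less_iff_less_mult)
        thus ?thesis using multiplicity_central_binomial_eq_0[OF p(1) sq] by simp
      qed
    qed
  qed
  also have "\<dots> = (\<Prod>p\<in>?P. if p ^ 2 \<le> 2 * n then 2 * n else 1) * (\<Prod>p\<in>?P. if p \<le> 2 * n div 3 then p else 1)
      * (\<Prod>p\<in>?P. if n < p then 2 * n else 1)"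
    by (simp add: prod.distrib)
  also have "(\<Prod>p\<in>?P. if p ^ 2 \<le> 2 * n then 2 * n else 1) = (2 * n) ^ card ?A1"
  proof -
    have "{p\<in>?P. p ^ 2 \<le> 2 * n} = ?A1"
      using power2_nat_le_imp_le by blast
    thus ?thesis using fP by (simp flip: prod.inter_filter)
  qed
  also have "(\<Prod>p\<in>?P. if p \<le> 2 * n div 3 then p else 1) = \<Prod>?A2"
  proof -
    have "{p\<in>?P. p \<le> 2 * n div 3} = ?A2" by auto
    thus ?thesis using fP by (simp flip: prod.inter_filter)
  qed
  also have "(\<Prod>p\<in>?P. if n < p then 2 * n else 1) = (2 * n) ^ card ?A3"
  proof -
    have "{p\<in>?P. n < p} = ?A3" by auto
    thus ?thesis using fP by (simp flip: prod.inter_filter)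
  qed
  finally show ?thesis
    by (rule order.trans) (intro mult_le_mono order.refl primorial_le)
qed

text \<open>Logarithms of 4^n / (2n) <= (2n choose n) <= product bound. Of n ln 4 a third survives
  the factor 4^(2n/3), sqrt (2n) bounds the number of primes with p^2 <= 2n, and the final 1 comes
  from the denominator 2n.\<close>

lemma card_primes_upper_half_lower_bound:
  fixes n :: nat
  assumes "n > 0"
  shows "real n * ln 4 / (3 * ln (2 * real n)) - sqrt (2 * real n) - 1
           \<le> real (card {p. prime p \<and> n < p \<and> p \<le> 2 * n})"
proof -
  define a where "a = card {p. prime p \<and> p ^ 2 \<le> 2 * n}"
  define b where "b = card {p. prime p \<and> n < p \<and> p \<le> 2 * n}"
  define L where "L = ln (2 * real n)"
  have L: "L > 0" using assms by (simp add: L_def)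
  have "{p. prime p \<and> p ^ 2 \<le> 2 * n} \<subseteq> {1..nat \<lfloor>sqrt (2 * real n)\<rfloor>}"
  proof safe
    fix p :: nat assume p: "prime p" "p ^ 2 \<le> 2 * n"
    hence "real p ^ 2 \<le> 2 * real n" by (metis of_nat_le_iff of_nat_mult of_nat_numeral of_nat_power)
    hence "real p \<le> sqrt (2 * real n)" by (rule real_le_rsqrt)
    thus "p \<in> {1..nat \<lfloor>sqrt (2 * real n)\<rfloor>}" using prime_gt_0_nat[OF p(1)] by (auto simp: le_nat_floor)
  qed
  from card_mono[OF _ this] have "a \<le> nat \<lfloor>sqrt (2 * real n)\<rfloor>" by (simp add: a_def)
  moreover have "0 \<le> \<lfloor>sqrt (2 * real n)\<rfloor>" by simp
  ultimately have "int a \<le> \<lfloor>sqrt (2 * real n)\<rfloor>" by linarith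
  hence a: "real a \<le> sqrt (2 * real n)" by (simp add: le_floor_iff)
  have "4 ^ n / (2 * real n) \<le> real ((2 * n) choose n)"
    using assms by (rule central_binomial_lower_bound)
  also have "\<dots> \<le> real ((2 * n) ^ a * 4 ^ (2 * n div 3) * (2 * n) ^ b)"
    unfolding a_def b_def of_nat_le_iff using assms by (rule central_binomial_le_prime_products)
  finally have "4 ^ n / (2 * real n) \<le> (2 * real n) ^ a * 4 ^ (2 * n div 3) * (2 * real n) ^ b"
    by simp
  hence "ln (4 ^ n / (2 * real n)) \<le> ln ((2 * real n) ^ a * 4 ^ (2 * n div 3) * (2 * real n) ^ b)"
    using assms by (intro ln_mono) auto
  moreover have "ln (4 ^ n / (2 * real n)) = real n * ln 4 - L"
    using assms by (subst ln_div) (simp_all add: ln_realpow L_def)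
  moreover have "ln ((2 * real n) ^ a * 4 ^ (2 * n div 3) * (2 * real n) ^ b)
      = real a * L + real (2 * n div 3) * ln 4 + real b * L"
  proof -
    have "ln ((2 * real n) ^ a * 4 ^ (2 * n div 3) * (2 * real n) ^ b) =
        ln ((2 * real n) ^ a) + ln (4 ^ (2 * n div 3)) + ln ((2 * real n) ^ b)"
      using assms by (subst ln_mult_pos; (subst ln_mult_pos)?; simp)
    thus ?thesis using assms by (simp only: L_def ln_realpow)
  qed
  moreover have "real (2 * n div 3) * ln 4 \<le> (2 * real n / 3) * ln 4"
    by (intro mult_right_mono) (use of_nat_div_le_of_nat[of "2*n" 3, where 'a=real] in auto)
  ultimately have "real n * ln 4 - L \<le> real a * L + (2 * real n / 3) * ln 4 + real b * L"
    by linarith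
  hence "real n * ln 4 / 3 \<le> (real a + 1 + real b) * L" by (simp add: algebra_simps)
  hence "real n * ln 4 / (3 * L) \<le> real a + 1 + real b" using L by (simp add: field_simps)
  thus ?thesis using a unfolding L_def b_def by linarith
qed

section \<open>The random moduli: how many there are, and how many divide a given integer\<close>

lemma finite_prime_range [simp]: "finite (prime_range M)"
  by (rule finite_subset[of _ "{..M}"]) (auto simp: prime_range_def)

text \<open>The strict bound N > ceil (M/2) yields N - 1 >= M/2, the form in which moduli enter
  later; the factors 2 in 2 / ((1 - \<tau>) M) and in 2 / (\<tau> M) originate here.\<close>

lemma prime_rangeD:
  assumes "N \<in> prime_range M"
  shows "prime N" "N \<ge> 2" "N \<le> M" "real M / 2 \<le> real N - 1"
proof -
  show "prime N" "N \<ge> 2" "N \<le> M" using assms prime_ge_2_nat by (auto simp: prime_range_def)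
  have "\<lceil>real M / 2\<rceil> \<le> int N - 1" using assms by (auto simp: prime_range_def)
  thus "real M / 2 \<le> real N - 1" by linarith
qed

text \<open>For odd M = 2n + 1 the range starts above ceil (M/2) = n + 1, so the prime n + 1 of (n,
  2n] may be lost; hence the 1.\<close>

lemma card_prime_range_ge:
  "real (card {p. prime p \<and> n < p \<and> p \<le> 2 * n}) - 1 \<le> real (card (prime_range M))"
  if "n = M div 2"
proof -
  have "{p. prime p \<and> n < p \<and> p \<le> 2 * n} \<subseteq> insert (n + 1) (prime_range M)"
  proof
    fix p assume p: "p \<in> {p. prime p \<and> n < p \<and> p \<le> 2 * n}"
    have "real M / 2 \<le> real_of_int (int n + 1)" using that by (simp add: field_simps)
    hence "\<lceil>real M / 2\<rceil> \<le> int n + 1" by (simp only: ceiling_le_iff)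
    thus "p \<in> insert (n + 1) (prime_range M)" using p that by (auto simp: prime_range_def)
  qed
  from card_mono[OF _ this] show ?thesis by (simp add: card_insert_if split: if_splits)
qed

lemma eventually_card_prime_range_ge:
  assumes "0 < \<epsilon>" "\<epsilon> < 1"
  shows "\<forall>\<^sub>F M in at_top. real M powr (1 - \<epsilon>) \<le> real (card (prime_range M))"
proof -
  \<comment> \<open>The variable x stands for n = M div 2, so M <= 2x + 1; ln 4 is lowered to 1; the
    2 collects the 1 of the prime count and the 1 of the prime n + 1 that may be lost.\<close>
  have *: "\<forall>\<^sub>F x::real in at_top. (2 * x + 1) powr (1 - \<epsilon>) \<le> x * 1 / (3 * ln (2 * x)) - sqrt (2 * x) - 2"
    using assms by real_asymp
  have "filterlim (\<lambda>M::nat. real M / 2 - 1) at_top at_top" by real_asymp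
  hence lim: "filterlim (\<lambda>M::nat. real (M div 2)) at_top at_top"
    by (rule filterlim_at_top_mono) (intro always_eventually allI, linarith)
  have ln4: "1 \<le> ln (4::real)" using exp_le by (subst ln_ge_iff) auto
  from eventually_compose_filterlim[OF * lim] eventually_ge_at_top[of 2]
  show ?thesis
  proof eventually_elim
    case (elim M)
    let ?n = "M div 2"
    have "real M powr (1 - \<epsilon>) \<le> (2 * real ?n + 1) powr (1 - \<epsilon>)"
      using assms by (intro powr_mono2) linarith+
    also have "\<dots> \<le> real ?n * 1 / (3 * ln (2 * real ?n)) - sqrt (2 * real ?n) - 2" by (rule elim)
    also have "\<dots> \<le> real ?n * ln 4 / (3 * ln (2 * real ?n)) - sqrt (2 * real ?n) - 2"
      using ln4 elim by (intro diff_right_mono divide_right_mono mult_left_mono) auto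
    also have "\<dots> \<le> real (card {p. prime p \<and> ?n < p \<and> p \<le> 2 * ?n}) - 1"
      using card_primes_upper_half_lower_bound[of ?n] elim by linarith
    also have "\<dots> \<le> real (card (prime_range M))" by (rule card_prime_range_ge) simp
    finally show ?case .
  qed
qed

lemma card_prime_range_lower_bound:
  assumes "0 < \<epsilon>" "\<epsilon> < 1"
  obtains C where "C > 0"
    "\<And>M. prime_range M \<noteq> {} \<Longrightarrow> real M powr (1 - \<epsilon>) \<le> C * real (card (prime_range M))"
proof -
  from eventually_card_prime_range_ge[OF assms] obtain M0 where
    M0: "\<And>M. M \<ge> M0 \<Longrightarrow> real M powr (1 - \<epsilon>) \<le> real (card (prime_range M))"
    by (auto simp: eventually_at_top_linorder)
  show thesis
  \<comment> \<open>Below \<open>M0\<close> it suffices that a nonempty range has at least one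
    element, as M^(1 - \<epsilon>) <= M <= M0 + 1.\<close>
  proof (rule that[of "real M0 + 1"])
    fix M assume ne: "prime_range M \<noteq> {}"
    hence "card (prime_range M) > 0" by (simp add: card_gt_0_iff)
    hence c1: "real (card (prime_range M)) \<ge> 1" by linarith
    show "real M powr (1 - \<epsilon>) \<le> (real M0 + 1) * real (card (prime_range M))"
    proof (cases "M \<ge> M0")
      case True
      have "real M powr (1 - \<epsilon>) \<le> 1 * real (card (prime_range M))" using M0[OF True] by simp
      also have "\<dots> \<le> (real M0 + 1) * real (card (prime_range M))" by (intro mult_right_mono) auto
      finally show ?thesis .
    next
      case False
      obtain N where "N \<in> prime_range M" using ne by blast
      hence M1: "real M \<ge> 1" using prime_rangeD(2,3)[of N M] by linarith
      have "real M powr (1 - \<epsilon>) \<le> real M powr 1" using M1 assms by (intro powr_mono) auto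
      also have "\<dots> \<le> (real M0 + 1) * 1" using False M1 by simp
      also have "\<dots> \<le> (real M0 + 1) * real (card (prime_range M))"
        using c1 by (intro mult_left_mono) auto
      finally show ?thesis .
    qed
  qed simp
qed

text \<open>The distinct primes in \<open>A\<close> multiply to a divisor of \<open>k\<close> and
  each is at least 2. Hence at most log_2 |k| primes divide \<open>k\<close>.\<close>

lemma two_power_card_prime_divisors_le:
  fixes k :: int
  assumes "finite A" "\<And>p. p \<in> A \<Longrightarrow> prime p" "\<And>p. p \<in> A \<Longrightarrow> int p dvd k" "k \<noteq> 0"
  shows "2 ^ card A \<le> \<bar>real_of_int k\<bar>"
proof -
  have "\<Prod>A dvd nat \<bar>k\<bar>"
    using assms by (intro prod_primes_dvd) auto
  hence "\<Prod>A \<le> nat \<bar>k\<bar>" using assms by (intro dvd_imp_le) auto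
  moreover have "(\<Prod>p\<in>A. 2) \<le> \<Prod>A" using assms(2) prime_ge_2_nat by (intro prod_mono) auto
  ultimately have "2 ^ card A \<le> nat \<bar>k\<bar>" by (metis order.trans prod_constant)
  hence "real (2 ^ card A) \<le> real (nat \<bar>k\<bar>)" by (simp only: of_nat_le_iff)
  thus ?thesis by simp
qed

text \<open>The exponent \<delta> is spent in two halves. One dominates ln |k|, which bounds the
  number of prime divisors; the other pays for M^(\<delta>/2), the gap between M and the guaranteed
  number of moduli, because a modulus dividing k forces M <= 2 |k|. An empty range gives 0 on the
  left by x / 0 = 0.\<close>

lemma prime_range_dvd_proportion:
  assumes "0 < \<delta>" "\<delta> < 1"
  obtains C where "C > 0"
    "\<And>M k. k \<noteq> (0::int) \<Longrightarrow> real (card {N\<in>prime_range M. int N dvd k}) / real (card (prime_range M))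
        \<le> C * \<bar>real_of_int k\<bar> powr \<delta> / real M"
proof -
  from assms obtain C where C: "C > 0"
    "\<And>M. prime_range M \<noteq> {} \<Longrightarrow> real M powr (1 - \<delta> / 2) \<le> C * real (card (prime_range M))"
    using card_prime_range_lower_bound[of "\<delta> / 2"] by auto
  \<comment> \<open>The factor 2^(\<delta>/2) comes from M <= 2x, and 2 / (\<delta> ln 2) from ln x
    <= x^(\<delta>/2) / (\<delta>/2) divided by ln 2.\<close>
  define D where "D = C * (2 powr (\<delta> / 2) * (2 / (\<delta> * ln 2)))"
  have D: "D > 0" using C assms by (simp add: D_def)
  show thesis
  proof (rule that[OF D])
    fix M :: nat and k :: int assume k: "k \<noteq> 0"
    define A where "A = {N\<in>prime_range M. int N dvd k}"
    define x where "x = \<bar>real_of_int k\<bar>"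
    have x1: "x \<ge> 1" using k by (simp add: x_def)
    show "real (card {N\<in>prime_range M. int N dvd k}) / real (card (prime_range M))
        \<le> D * \<bar>real_of_int k\<bar> powr \<delta> / real M"
    proof (cases "A = {}")
      case True
      thus ?thesis using D by (simp add: A_def del: Collect_empty_eq)
    next
      case False
      then obtain N where N: "N \<in> prime_range M" "int N dvd k" by (auto simp: A_def)
      hence ne: "prime_range M \<noteq> {}" by auto
      hence cp: "real (card (prime_range M)) > 0" by (simp add: card_gt_0_iff)
      have M0: "real M > 0" using prime_rangeD(2,3)[OF N(1)] by simp
      have "int N \<le> \<bar>k\<bar>" using dvd_imp_le_int[OF k N(2)] by simp
      hence "real N \<le> x" unfolding x_def by linarith
      hence Mx: "real M \<le> 2 * x" using prime_rangeD(4)[OF N(1)] by linarith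
      have "2 ^ card A \<le> x" unfolding x_def
        using k by (intro two_power_card_prime_divisors_le) (auto simp: A_def prime_range_def)
      hence "ln (2 ^ card A) \<le> ln x" by (intro ln_mono) auto
      hence "real (card A) * ln 2 \<le> ln x" by (simp add: ln_realpow)
      also have "\<dots> \<le> x powr (\<delta> / 2) / (\<delta> / 2)" using x1 assms by (intro ln_powr_bound) auto
      finally have cA: "real (card A) \<le> x powr (\<delta> / 2) * (2 / (\<delta> * ln 2))"
        using assms by (simp add: field_simps)
      have "real M = real M powr (1 - \<delta> / 2) * real M powr (\<delta> / 2)"
        using M0 by (simp flip: powr_add)
      also have "\<dots> \<le> (C * real (card (prime_range M))) * (2 * x) powr (\<delta> / 2)"
        using C(1) C(2)[OF ne] Mx assms by (intro mult_mono powr_mono2) auto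
      finally have "real (card A) * real M \<le> (x powr (\<delta> / 2) * (2 / (\<delta> * ln 2))) *
          ((C * real (card (prime_range M))) * (2 * x) powr (\<delta> / 2))"
        using cA by (intro mult_mono) auto
      also have "\<dots> = D * (x powr (\<delta> / 2) * x powr (\<delta> / 2)) * real (card (prime_range M))"
        using x1 by (simp add: D_def powr_mult)
      also have "x powr (\<delta> / 2) * x powr (\<delta> / 2) = x powr \<delta>" by (simp flip: powr_add)
      finally have "real (card A) * real M \<le> D * x powr \<delta> * real (card (prime_range M))" .
      hence "real (card A) \<le> D * x powr \<delta> / real M * real (card (prime_range M))"
        unfolding times_divide_eq_left pos_le_divide_eq[OF M0] .
      thus ?thesis unfolding pos_divide_le_eq[OF cp] A_def x_def .
    qed
  qed
qed

section \<open>Sums over the integer lattice\<close>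

text \<open>Jensen's inequality for sums. With T the sum of the powers, each
  \<open>f x powr \<mu>\<close> is at most T, so
  \<open>f x = f x powr \<mu> * f x powr (1 - \<mu>)\<close> is at most
  \<open>f x powr \<mu>\<close> times a fixed power of T. This gives summability and, after summing,
  \<open>infsum f A \<le> T powr (1 / \<mu>)\<close>.\<close>

lemma infsum_powr_le:
  fixes f :: "'a \<Rightarrow> real"
  assumes \<mu>: "0 < \<mu>" "\<mu> \<le> 1" and f: "\<And>x. x \<in> A \<Longrightarrow> f x \<ge> 0"
    and s: "(\<lambda>x. f x powr \<mu>) summable_on A"
  shows "f summable_on A" "(infsum f A) powr \<mu> \<le> infsum (\<lambda>x. f x powr \<mu>) A"
proof -
  define T where "T = infsum (\<lambda>x. f x powr \<mu>) A"
  have T0: "T \<ge> 0" unfolding T_def by (intro infsum_nonneg) auto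
  have le: "f x \<le> f x powr \<mu> * T powr ((1 - \<mu>) / \<mu>)" if "x \<in> A" for x
  proof -
    have "sum (\<lambda>x. f x powr \<mu>) {x} \<le> T"
      unfolding T_def using that s by (intro finite_sum_le_infsum) auto
    hence "(f x powr \<mu>) powr ((1 - \<mu>) / \<mu>) \<le> T powr ((1 - \<mu>) / \<mu>)"
      using \<mu> by (intro powr_mono2) auto
    hence "f x powr \<mu> * f x powr (1 - \<mu>) \<le> f x powr \<mu> * T powr ((1 - \<mu>) / \<mu>)"
      using \<mu> by (intro mult_left_mono) (auto simp: powr_powr)
    moreover have "f x powr \<mu> * f x powr (1 - \<mu>) = f x"
      using f[OF that] by (simp flip: powr_add)
    ultimately show ?thesis by simp
  qed
  have s': "(\<lambda>x. f x powr \<mu> * T powr ((1 - \<mu>) / \<mu>)) summable_on A"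
    using s by (rule summable_on_cmult_left)
  show s2: "f summable_on A"
    by (rule summable_on_comparison_test[OF s']) (use le f in auto)
  have "infsum f A \<le> infsum (\<lambda>x. f x powr \<mu> * T powr ((1 - \<mu>) / \<mu>)) A"
    by (intro infsum_mono s2 s' le)
  also have "\<dots> = T powr 1 * T powr ((1 - \<mu>) / \<mu>)"
    using T0 s by (simp add: infsum_cmult_left T_def)
  also have "\<dots> = T powr (1 / \<mu>)"
    unfolding powr_add[symmetric] using \<mu> by (simp add: field_simps)
  finally have "(infsum f A) powr \<mu> \<le> (T powr (1 / \<mu>)) powr \<mu>"
    using \<mu> f by (intro powr_mono2 infsum_nonneg) auto
  thus "(infsum f A) powr \<mu> \<le> infsum (\<lambda>x. f x powr \<mu>) A"
    using \<mu> T0 by (simp add: powr_powr flip: T_def)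
qed

lemma has_sum_sum:
  fixes f :: "'i \<Rightarrow> 'a \<Rightarrow> 'b::topological_comm_monoid_add"
  assumes "\<And>i. i \<in> I \<Longrightarrow> (f i has_sum S i) A"
  shows "((\<lambda>x. \<Sum>i\<in>I. f i x) has_sum (\<Sum>i\<in>I. S i)) A"
  using assms by (induction I rule: infinite_finite_induct) (auto intro: has_sum_add)

lemma powr_add_le:
  fixes x y :: real
  assumes "0 < \<mu>" "\<mu> \<le> 1" "x \<ge> 0" "y \<ge> 0"
  shows "(x + y) powr \<mu> \<le> x powr \<mu> + y powr \<mu>"
  using infsum_powr_le(2)[of \<mu> "{True, False}" "\<lambda>b. if b then x else y"] assms by simp

lemma prod_one_plus_Pow:
  fixes f :: "'a \<Rightarrow> 'b::comm_ring_1"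
  assumes "finite A"
  shows "(\<Prod>x\<in>A. 1 + f x) = 1 + (\<Sum>u\<in>Pow A - {{}}. \<Prod>x\<in>u. f x)"
proof -
  have "(\<Prod>x\<in>A. 1 + f x) = (\<Sum>u\<in>Pow A. \<Prod>x\<in>u. f x)"
    using prod_add[OF assms, of f "\<lambda>_. 1"] by (simp add: add.commute)
  also have "\<dots> = 1 + (\<Sum>u\<in>Pow A - {{}}. \<Prod>x\<in>u. f x)"
    using assms by (subst sum.remove[of _ "{}"]) auto
  finally show ?thesis .
qed

section \<open>Frequency weights and their sums over the integer lattice\<close>

definition coord_weight :: "real \<Rightarrow> real \<Rightarrow> int \<Rightarrow> real" where
  "coord_weight a c m = (if m = 0 then 1 else c / \<bar>real_of_int m\<bar> powr a)"

text \<open>The parameters a = 2 \<alpha> and c_j = \<gamma>_j^2 give 1/r^2, and a power \<mu> of it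
  stays in the family, with a \<mu> and c_j^\<mu>. Running over all coordinates, with factor 1 at a
  zero entry, makes sums over the integer lattice factorize.\<close>

definition freq_weight :: "real \<Rightarrow> (nat \<Rightarrow> real) \<Rightarrow> nat \<Rightarrow> (nat \<Rightarrow> int) \<Rightarrow> real" where
  "freq_weight a c l k = (\<Prod>j\<in>{1..l}. coord_weight a (c j) (k j))"

lemma coord_weight_nonneg [simp]: "c \<ge> 0 \<Longrightarrow> coord_weight a c m \<ge> 0"
  by (simp add: coord_weight_def)

lemma freq_weight_nonneg: "(\<And>j. j \<ge> 1 \<Longrightarrow> c j \<ge> 0) \<Longrightarrow> freq_weight a c l k \<ge> 0"
  unfolding freq_weight_def by (intro prod_nonneg) auto

text \<open>Vanishing weights are included: a frequency with k_j \<noteq> 0 and \<gamma>_j = 0 has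
  \<open>r_weight\<close> 0, and 1 / 0 = 0 agrees with the vanishing factor on the right.\<close>

lemma inverse_r_weight_sq: "1 / (r_weight l \<alpha> \<gamma> k)\<^sup>2 = freq_weight (2 * \<alpha>) (\<lambda>j. (\<gamma> j)\<^sup>2) l k"
proof -
  have "1 / (r_weight l \<alpha> \<gamma> k)\<^sup>2 =
      (\<Prod>j\<in>{j\<in>{1..l}. k j \<noteq> 0}. (\<gamma> j)\<^sup>2 / \<bar>real_of_int (k j)\<bar> powr (2 * \<alpha>))"
    unfolding r_weight_def power2_eq_square prod.distrib[symmetric] prod_inversef[symmetric] divide_inverse_commute mult_1_right
    by (intro prod.cong) (auto simp: field_simps simp flip: powr_add)
  also have "\<dots> = freq_weight (2 * \<alpha>) (\<lambda>j. (\<gamma> j)\<^sup>2) l k"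
    unfolding freq_weight_def coord_weight_def
    by (subst prod.inter_filter) (auto intro!: prod.cong)
  finally show ?thesis .
qed

lemma freq_weight_powr:
  assumes "\<And>j. j \<ge> 1 \<Longrightarrow> c j \<ge> 0"
  shows "freq_weight a c l k powr \<mu> = freq_weight (a * \<mu>) (\<lambda>j. c j powr \<mu>) l k"
  unfolding freq_weight_def using assms
  by (subst prod_powr_distrib) (auto intro!: prod.cong simp: coord_weight_def powr_divide powr_powr)

lemma riemann_zeta_summable:
  "a > 1 \<Longrightarrow> summable (\<lambda>n. 1 / real (Suc n) powr a)"
  using summable_real_powr_iff[of "-a"] summable_Suc_iff[of "\<lambda>n. real n powr (-a)"]
  by (simp add: powr_minus_divide)

lemma riemann_zeta_nonneg: "a > 1 \<Longrightarrow> riemann_zeta a \<ge> 0"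
  unfolding riemann_zeta_def by (intro suminf_nonneg riemann_zeta_summable) auto

lemma has_sum_nonzero_int:
  assumes "a > 1" "c \<ge> 0"
  shows "((\<lambda>m::int. c / \<bar>real_of_int m\<bar> powr a) has_sum (c * (2 * riemann_zeta a))) {m. m \<noteq> 0}"
proof -
  have *: "((\<lambda>n. c * (1 / real (Suc n) powr a)) has_sum (c * riemann_zeta a)) UNIV"
    unfolding riemann_zeta_def using assms
    by (intro sums_nonneg_imp_has_sum sums_mult summable_sums riemann_zeta_summable) auto
  have p: "((\<lambda>m::int. c / \<bar>real_of_int m\<bar> powr a) has_sum (c * riemann_zeta a)) {0<..}"
  proof -
    have "bij_betw (\<lambda>n. int (Suc n)) UNIV {0<..}"
      by (rule bij_betwI[of _ _ _ "\<lambda>m. nat m - 1"]) auto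
    from has_sum_reindex_bij_betw[OF this, of "\<lambda>m. c / \<bar>real_of_int m\<bar> powr a"] show ?thesis using * by (simp add: add.commute)
  qed
  have n: "((\<lambda>m::int. c / \<bar>real_of_int m\<bar> powr a) has_sum (c * riemann_zeta a)) {..<0}"
  proof -
    have "bij_betw uminus {0<..} {..<0::int}"
      by (rule bij_betwI[of _ _ _ uminus]) auto
    from has_sum_reindex_bij_betw[OF this, of "\<lambda>m. c / \<bar>real_of_int m\<bar> powr a"] show ?thesis using p by simp
  qed
  have "{m::int. m \<noteq> 0} = {0<..} \<union> {..<0}" by auto
  thus ?thesis using has_sum_Un_disjoint[OF p n] by (simp add: disjoint_iff algebra_simps)
qed

lemma has_sum_nonzero_multiples:
  assumes "a > 1" "c \<ge> 0" "N > 0"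
  shows "((\<lambda>m::int. c / \<bar>real_of_int m\<bar> powr a) has_sum (c * (2 * riemann_zeta a) / real N powr a))
           {m. m \<noteq> 0 \<and> int N dvd m}"
proof -
  have "bij_betw (\<lambda>m. int N * m) {m. m \<noteq> 0} {m. m \<noteq> 0 \<and> int N dvd m}"
    using assms by (intro bij_betwI[of _ _ _ "\<lambda>m. m div int N"]) auto
  from has_sum_reindex_bij_betw[OF this, of "\<lambda>m. c / \<bar>real_of_int m\<bar> powr a"]
  show ?thesis
    using has_sum_nonzero_int[OF assms(1), of "c / real N powr a"] assms
    by (simp add: abs_mult powr_mult mult.commute)
qed

lemma has_sum_coord_weight:
  assumes "a > 1" "c \<ge> 0"
  shows "(coord_weight a c has_sum (1 + c * (2 * riemann_zeta a))) UNIV"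
proof -
  have "(coord_weight a c has_sum (c * (2 * riemann_zeta a))) {m. m \<noteq> 0}"
    using has_sum_nonzero_int[OF assms] by (rule has_sum_cong[THEN iffD1, rotated]) (auto simp: coord_weight_def)
  moreover have "(coord_weight a c has_sum 1) {0}"
    by (auto intro!: has_sum_finiteI simp: coord_weight_def)
  moreover have "(UNIV::int set) = {0} \<union> {m. m \<noteq> 0}" by auto
  ultimately show ?thesis
    using has_sum_Un_disjoint[of "coord_weight a c" "{0}" 1 "{m. m \<noteq> 0}"] by simp
qed

lemma bij_betw_int_vecs_Suc:
  "bij_betw (\<lambda>(k, m). k(Suc l := m)) (int_vecs l \<times> UNIV) (int_vecs (Suc l))"
proof -
  have eq: "{1..Suc l} = insert (Suc l) {1..l}" by auto
  have "inj_on (\<lambda>(k, m). k(Suc l := m)) (int_vecs l \<times> (UNIV :: int set))"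
    unfolding int_vecs_def by (rule inj_combinator') simp
  moreover have "int_vecs (Suc l) = (\<lambda>(k, m). k(Suc l := m)) ` (int_vecs l \<times> (UNIV :: int set))"
    unfolding int_vecs_def eq PiE_insert_eq by force
  ultimately show ?thesis by (simp add: bij_betw_def)
qed

lemma freq_weight_Suc:
  "freq_weight a c (Suc l) (k(Suc l := m)) = freq_weight a c l k * coord_weight a (c (Suc l)) m"
proof -
  have "freq_weight a c (Suc l) (k(Suc l := m)) =
      (\<Prod>j\<in>{1..l}. coord_weight a (c j) ((k(Suc l := m)) j)) * coord_weight a (c (Suc l)) m"
    by (simp add: freq_weight_def)
  also have "(\<Prod>j\<in>{1..l}. coord_weight a (c j) ((k(Suc l := m)) j)) = freq_weight a c l k"
    unfolding freq_weight_def by (intro prod.cong) auto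
  finally show ?thesis .
qed

lemma has_sum_freq_weight:
  assumes a: "a > 1" and c: "\<And>j. j \<ge> 1 \<Longrightarrow> c j \<ge> 0"
  shows "(freq_weight a c l has_sum (\<Prod>j\<in>{1..l}. 1 + c j * (2 * riemann_zeta a))) (int_vecs l)"
proof (induction l)
  case 0
  show ?case by (auto intro!: has_sum_finiteI simp: int_vecs_def freq_weight_def)
next
  case (Suc l)
  let ?P = "\<Prod>j\<in>{1..l}. 1 + c j * (2 * riemann_zeta a)"
  let ?t = "1 + c (Suc l) * (2 * riemann_zeta a)"
  let ?f = "\<lambda>(k, m). freq_weight a c l k * coord_weight a (c (Suc l)) m"
  have cw: "(coord_weight a (c (Suc l)) has_sum ?t) UNIV"
    by (rule has_sum_coord_weight) (use a c in auto)
  have 1: "((\<lambda>m. ?f (k, m)) has_sum (freq_weight a c l k * ?t)) UNIV" for k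
    using has_sum_cmult_right[OF cw] by simp
  have 2: "((\<lambda>k. freq_weight a c l k * ?t) has_sum (?P * ?t)) (int_vecs l)"
    by (rule has_sum_cmult_left[OF Suc])
  have "?f summable_on int_vecs l \<times> UNIV"
    by (rule summable_on_SigmaI[OF 1]) (use 2 c freq_weight_nonneg[of c] in \<open>auto simp: summable_on_def\<close>)
  hence "(?f has_sum (?P * ?t)) (int_vecs l \<times> UNIV)"
    by (intro has_sum_SigmaI[OF 1 2])
  hence "((\<lambda>p. freq_weight a c (Suc l) (case p of (k, m) \<Rightarrow> k(Suc l := m))) has_sum (?P * ?t)) (int_vecs l \<times> UNIV)"
    by (simp add: freq_weight_Suc case_prod_unfold)
  hence "(freq_weight a c (Suc l) has_sum (?P * ?t)) (int_vecs (Suc l))"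
    by (subst (asm) has_sum_reindex_bij_betw[OF bij_betw_int_vecs_Suc])
  thus ?case by simp
qed

lemma freq_weight_summable_on:
  assumes "a > 1" "\<And>j. j \<ge> 1 \<Longrightarrow> c j \<ge> 0" "A \<subseteq> int_vecs l"
  shows "freq_weight a c l summable_on A"
  using has_sum_imp_summable[OF has_sum_freq_weight[OF assms(1,2)]] assms(3)
  by (rule summable_on_subset_banach)

section \<open>Dual lattices and linear congruences modulo a prime\<close>

lemma mem_dual_lattice_iff:
  "k \<in> dual_lattice l N z \<longleftrightarrow> k \<in> int_vecs l \<and> int N dvd (\<Sum>j\<in>{1..l}. k j * int (z j))"
  by (simp add: dual_lattice_def cong_0_iff)

lemma dual_lattice_cong:
  "(\<And>j. j \<in> {1..l} \<Longrightarrow> z j = z' j) \<Longrightarrow> dual_lattice l N z = dual_lattice l N z'"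
  by (auto simp: mem_dual_lattice_iff)

lemma R_crit_cong:
  "(\<And>j. j \<in> {1..l} \<Longrightarrow> z j = z' j) \<Longrightarrow> R_crit l \<alpha> \<gamma> N z = R_crit l \<alpha> \<gamma> N z'"
  unfolding R_crit_def using dual_lattice_cong[of l z z'] by simp

lemma upd_mem_dual_lattice_Suc:
  assumes "k \<in> int_vecs l"
  shows "k(Suc l := m) \<in> dual_lattice (Suc l) N z \<longleftrightarrow>
           int N dvd (\<Sum>j\<in>{1..l}. k j * int (z j)) + m * int (z (Suc l))"
proof -
  have "k(Suc l := m) \<in> int_vecs (Suc l)"
    using bij_betw_apply[OF bij_betw_int_vecs_Suc, of "(k, m)"] assms by simp
  moreover have "(\<Sum>j\<in>{1..l}. (k(Suc l := m)) j * int (z j)) = (\<Sum>j\<in>{1..l}. k j * int (z j))"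
    by (intro sum.cong) auto
  ultimately show ?thesis by (simp add: mem_dual_lattice_iff)
qed

text \<open>\<open>m\<close> is invertible modulo the prime \<open>N\<close>, and
  \<open>{1..<N}\<close> contains no two congruent integers.\<close>

lemma card_solutions_le:
  fixes N :: nat and h m :: int
  assumes "prime N" "\<not> int N dvd m"
  shows "card {\<zeta>\<in>{1..<N}. int N dvd h + m * int \<zeta>} \<le> 1"
proof -
  have False if xy: "x \<in> {\<zeta>\<in>{1..<N}. int N dvd h + m * int \<zeta>}"
    "y \<in> {\<zeta>\<in>{1..<N}. int N dvd h + m * int \<zeta>}" "x < y" for x y
  proof -
    from xy have "int N dvd (h + m * int y) - (h + m * int x)" by (intro dvd_diff) auto
    hence "int N dvd m * int (y - x)" using xy by (simp add: algebra_simps of_nat_diff)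
    hence "int N dvd int (y - x)" using assms prime_dvd_mult_iff[of "int N" m "int (y - x)"] by simp
    hence "N dvd y - x" by (simp only: of_nat_dvd_iff)
    thus False using xy dvd_imp_le[of N "y - x"] by auto
  qed
  hence "\<forall>x\<in>{\<zeta>\<in>{1..<N}. int N dvd h + m * int \<zeta>}. \<forall>y\<in>{\<zeta>\<in>{1..<N}. int N dvd h + m * int \<zeta>}. x = y"
    by (meson linorder_neqE_nat)
  thus ?thesis by (subst One_nat_def, subst card_le_Suc0_iff_eq) simp_all
qed

lemma card_solutions_dvd:
  fixes N :: nat and h m :: int
  assumes "prime N" "int N dvd h"
  shows "card {\<zeta>\<in>{1..<N}. int N dvd h + m * int \<zeta>} = (if int N dvd m then N - 1 else 0)"
proof (cases "int N dvd m")
  case True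
  hence "{\<zeta>\<in>{1..<N}. int N dvd h + m * int \<zeta>} = {1..<N}" using assms by auto
  thus ?thesis using True by (simp only: card_atLeastLessThan if_True)
next
  case False
  have "\<not> int N dvd h + m * int \<zeta>" if "\<zeta> \<in> {1..<N}" for \<zeta>
  proof
    assume "int N dvd h + m * int \<zeta>"
    hence "int N dvd m * int \<zeta>" using assms by (simp add: dvd_add_right_iff)
    hence "int N dvd int \<zeta>" using assms False prime_dvd_mult_iff[of "int N" m "int \<zeta>"] by simp
    hence "N dvd \<zeta>" by (simp only: of_nat_dvd_iff)
    thus False using that dvd_imp_le[of N \<zeta>] by auto
  qed
  thus ?thesis using False by auto
qed

text \<open>If \<open>N\<close> divides \<open>h\<close>, then only the multiples \<open>m\<close> of \<open>N\<close> admit solutions; the loss of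
  the factor \<open>N - 1\<close> is made up for by the factor \<open>N powr - a\<close> coming from their sparsity.\<close>

lemma infsum_solutions_le:
  fixes N :: nat and h :: int
  assumes "prime N" "a > 1" "c \<ge> 0"
  shows "(\<lambda>m. c / \<bar>real_of_int m\<bar> powr a * real (card {\<zeta>\<in>{1..<N}. int N dvd h + m * int \<zeta>})) summable_on {m. m \<noteq> 0}"
    and "(\<Sum>\<^sub>\<infinity>m\<in>{m. m \<noteq> 0}. c / \<bar>real_of_int m\<bar> powr a * real (card {\<zeta>\<in>{1..<N}. int N dvd h + m * int \<zeta>}))
           \<le> c * (2 * riemann_zeta a)"
proof -
  let ?n = "\<lambda>m. real (card {\<zeta>\<in>{1..<N}. int N dvd h + m * int \<zeta>})"
  let ?w = "\<lambda>m. c / \<bar>real_of_int m\<bar> powr a"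
  have N: "N \<ge> 2" using assms prime_ge_2_nat by blast
  have hs: "(?w has_sum (c * (2 * riemann_zeta a))) {m. m \<noteq> 0}"
    by (rule has_sum_nonzero_int) fact+
  have nN: "?n m \<le> real N" for m
  proof -
    have "card {\<zeta>\<in>{1..<N}. int N dvd h + m * int \<zeta>} \<le> card {1..<N}" by (rule card_mono) auto
    thus ?thesis unfolding card_atLeastLessThan by linarith
  qed
  show s: "(\<lambda>m. ?w m * ?n m) summable_on {m. m \<noteq> 0}"
    by (rule summable_on_comparison_test[OF summable_on_cmult_left[OF has_sum_imp_summable[OF hs], of "real N"]])
       (use nN assms in \<open>auto intro!: mult_left_mono divide_right_mono\<close>)
  show "(\<Sum>\<^sub>\<infinity>m\<in>{m. m \<noteq> 0}. ?w m * ?n m) \<le> c * (2 * riemann_zeta a)"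
  proof (cases "int N dvd h")
    case True
    have n: "?n m = (if int N dvd m then real N - 1 else 0)" for m
      unfolding card_solutions_dvd[OF assms(1) True] using N by (simp add: of_nat_diff)
    have "(\<Sum>\<^sub>\<infinity>m\<in>{m. m \<noteq> 0}. ?w m * ?n m) = (\<Sum>\<^sub>\<infinity>m\<in>{m. m \<noteq> 0 \<and> int N dvd m}. ?w m * (real N - 1))"
      unfolding n by (intro infsum_cong_neutral) auto
    also have "\<dots> = c * (2 * riemann_zeta a) / real N powr a * (real N - 1)"
      using has_sum_nonzero_multiples[OF assms(2,3), of N] N
      by (intro infsumI has_sum_cmult_left) auto
    also have "\<dots> = c * (2 * riemann_zeta a) * ((real N - 1) / real N powr a)" by simp
    also have "(real N - 1) / real N powr a \<le> 1"
    proof -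
      have "real N - 1 \<le> real N powr 1" using N by simp
      also have "\<dots> \<le> real N powr a" using N assms by (intro powr_mono) auto
      finally show ?thesis using N by (simp add: divide_le_eq_1)
    qed
    finally show ?thesis
      using assms riemann_zeta_nonneg[OF assms(2)] by (simp add: mult_left_mono)
  next
    case False
    have n1: "?n m \<le> 1" for m
    proof (cases "int N dvd m")
      case True
      hence "{\<zeta>\<in>{1..<N}. int N dvd h + m * int \<zeta>} = {}" using False
        by (auto simp: dvd_add_left_iff)
      thus ?thesis by (simp only: card.empty)
    next
      case F: False
      thus ?thesis using card_solutions_le[OF assms(1) F, of h] by simp
    qed
    have "(\<Sum>\<^sub>\<infinity>m\<in>{m. m \<noteq> 0}. ?w m * ?n m) \<le> (\<Sum>\<^sub>\<infinity>m\<in>{m. m \<noteq> 0}. ?w m)"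
    proof (rule infsum_mono[OF s has_sum_imp_summable[OF hs]])
      show "?w m * ?n m \<le> ?w m" for m by (rule mult_left_le[OF n1]) (use assms in simp)
    qed
    also have "\<dots> = c * (2 * riemann_zeta a)" using hs by (rule infsumI)
    finally show ?thesis .
  qed
qed


section \<open>The component-by-component construction\<close>

text \<open>The contribution of the newest coordinate to the criterion. Frequencies with k_l = 0
  reproduce the criterion in dimension l - 1, which the choice of z_l cannot influence, so ranking
  candidates by \<open>R_crit\<close> means ranking them by \<open>fresh_part\<close>.\<close>

definition fresh_part :: "nat \<Rightarrow> real \<Rightarrow> (nat \<Rightarrow> real) \<Rightarrow> nat \<Rightarrow> (nat \<Rightarrow> nat) \<Rightarrow> real" where
  "fresh_part l \<alpha> \<gamma> N z =
     (\<Sum>\<^sub>\<infinity>k\<in>{k\<in>dual_lattice l N z. k l \<noteq> 0}. freq_weight (2 * \<alpha>) (\<lambda>j. (\<gamma> j)\<^sup>2) l k)"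

lemma fresh_part_nonneg: "fresh_part l \<alpha> \<gamma> N z \<ge> 0"
  unfolding fresh_part_def by (intro infsum_nonneg freq_weight_nonneg) auto

text \<open>Padding by a zero entry. Vectors are extensional, so the entry at \<open>Suc l\<close>
  is \<open>undefined\<close> before padding and the inverse map is a restriction.\<close>

lemma bij_betw_dual_lattice_Suc:
  "bij_betw (\<lambda>k. k(Suc l := 0)) (dual_lattice l N z - {\<lambda>j\<in>{1..l}. 0})
     {k\<in>dual_lattice (Suc l) N z - {\<lambda>j\<in>{1..Suc l}. 0}. k (Suc l) = 0}"
proof (rule bij_betwI[of _ _ _ "\<lambda>k. restrict k {1..l}"])
  have r: "(\<lambda>j\<in>{1..Suc l}. 0) = (\<lambda>j\<in>{1..l}. 0::int)(Suc l := 0)" by (auto simp: restrict_def fun_eq_iff)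
  have e: "k (Suc l) = undefined" if "k \<in> int_vecs l" for k
    using that by (auto simp: int_vecs_def PiE_def extensional_def)
  show "(\<lambda>k. k(Suc l := 0)) \<in> dual_lattice l N z - {\<lambda>j\<in>{1..l}. 0} \<rightarrow>
      {k\<in>dual_lattice (Suc l) N z - {\<lambda>j\<in>{1..Suc l}. 0}. k (Suc l) = 0}"
  proof
    fix k assume k: "k \<in> dual_lattice l N z - {\<lambda>j\<in>{1..l}. 0}"
    hence ki: "k \<in> int_vecs l" by (simp add: mem_dual_lattice_iff)
    have "k(Suc l := 0) \<in> dual_lattice (Suc l) N z"
      unfolding upd_mem_dual_lattice_Suc[OF ki] using k by (simp add: mem_dual_lattice_iff)
    moreover have "k(Suc l := 0) \<noteq> (\<lambda>j\<in>{1..Suc l}. 0)"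
    proof
      assume eq: "k(Suc l := 0) = (\<lambda>j\<in>{1..Suc l}. 0)"
      have "k = (\<lambda>j\<in>{1..l}. 0)"
      proof
        fix j show "k j = (\<lambda>j\<in>{1..l}. 0) j"
          using fun_cong[OF eq, of j] e[OF ki] by (cases "j = Suc l") (auto simp: restrict_def)
      qed
      thus False using k by simp
    qed
    ultimately show "k(Suc l := 0) \<in> {k\<in>dual_lattice (Suc l) N z - {\<lambda>j\<in>{1..Suc l}. 0}. k (Suc l) = 0}"
      by simp
  qed
  show inv1: "restrict (k(Suc l := 0)) {1..l} = k" if "k \<in> dual_lattice l N z - {\<lambda>j\<in>{1..l}. 0}" for k
  proof -
    have "k \<in> int_vecs l" using that by (simp add: mem_dual_lattice_iff)
    thus ?thesis by (auto simp: int_vecs_def PiE_def extensional_def restrict_def fun_eq_iff)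
  qed
  have inv2: "(restrict k {1..l})(Suc l := 0) = k" if "k \<in> int_vecs (Suc l)" "k (Suc l) = 0" for k :: "nat \<Rightarrow> int"
    using that by (auto simp: int_vecs_def PiE_def extensional_def restrict_def fun_eq_iff)
  show "(restrict k {1..l})(Suc l := 0) = k"
    if "k \<in> {k\<in>dual_lattice (Suc l) N z - {\<lambda>j\<in>{1..Suc l}. 0}. k (Suc l) = 0}" for k
    using that by (intro inv2) (auto simp: mem_dual_lattice_iff)
  show "(\<lambda>k. restrict k {1..l}) \<in> {k\<in>dual_lattice (Suc l) N z - {\<lambda>j\<in>{1..Suc l}. 0}. k (Suc l) = 0}
      \<rightarrow> dual_lattice l N z - {\<lambda>j\<in>{1..l}. 0}"
  proof
    fix k assume k: "k \<in> {k\<in>dual_lattice (Suc l) N z - {\<lambda>j\<in>{1..Suc l}. 0}. k (Suc l) = 0}"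
    hence i2: "(restrict k {1..l})(Suc l := 0) = k" by (intro inv2) (auto simp: mem_dual_lattice_iff)
    have ri: "restrict k {1..l} \<in> int_vecs l" by (simp add: int_vecs_def)
    have "(restrict k {1..l})(Suc l := 0) \<in> dual_lattice (Suc l) N z" unfolding i2 using k by simp
    hence "restrict k {1..l} \<in> dual_lattice l N z"
      using upd_mem_dual_lattice_Suc[OF ri, of 0] ri by (simp add: mem_dual_lattice_iff)
    moreover have "restrict k {1..l} \<noteq> (\<lambda>j\<in>{1..l}. 0)"
    proof
      assume "restrict k {1..l} = (\<lambda>j\<in>{1..l}. 0)"
      hence "k = (\<lambda>j\<in>{1..Suc l}. 0)" using i2 r by metis
      thus False using k by blast
    qed
    ultimately show "restrict k {1..l} \<in> dual_lattice l N z - {\<lambda>j\<in>{1..l}. 0}" by simp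
  qed
qed

lemma R_crit_Suc:
  assumes "2 * \<alpha> > 1"
  shows "R_crit (Suc l) \<alpha> \<gamma> N z = R_crit l \<alpha> \<gamma> N z + fresh_part (Suc l) \<alpha> \<gamma> N z"
proof -
  let ?f = "\<lambda>l. freq_weight (2 * \<alpha>) (\<lambda>j. (\<gamma> j)\<^sup>2) l"
  let ?A = "{k\<in>dual_lattice (Suc l) N z - {\<lambda>j\<in>{1..Suc l}. 0}. k (Suc l) = 0}"
  let ?B = "{k\<in>dual_lattice (Suc l) N z. k (Suc l) \<noteq> 0}"
  have s: "?f (Suc l) summable_on A" if "A \<subseteq> dual_lattice (Suc l) N z" for A
    using that by (intro freq_weight_summable_on assms) (auto simp: mem_dual_lattice_iff)
  have "dual_lattice (Suc l) N z - {\<lambda>j\<in>{1..Suc l}. 0} = ?A \<union> ?B" by auto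
  hence "R_crit (Suc l) \<alpha> \<gamma> N z = infsum (?f (Suc l)) (?A \<union> ?B)"
    by (simp only: R_crit_def inverse_r_weight_sq)
  also have "\<dots> = infsum (?f (Suc l)) ?A + infsum (?f (Suc l)) ?B"
    by (rule infsum_Un_disjoint) (auto intro!: s)
  also have "infsum (?f (Suc l)) ?A = R_crit l \<alpha> \<gamma> N z"
    unfolding infsum_reindex_bij_betw[OF bij_betw_dual_lattice_Suc, symmetric] R_crit_def inverse_r_weight_sq
    by (simp add: freq_weight_Suc coord_weight_def)
  finally show ?thesis by (simp only: fresh_part_def)
qed

text \<open>The average over all candidates. Jensen moves the power 1/(2 lam) inside; exchanging
  sums then leaves, for each pair (k, m), the number of \<zeta> solving k.z + m \<zeta> = 0 mod N.
  For fixed k, summing over m \<noteq> 0 costs at most the zeta factor whatever k.z is, and the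
  remaining sum over k is a product.\<close>

lemma sum_fresh_part_powr_le:
  fixes N :: nat
  assumes N: "prime N" and lam: "1 / 2 \<le> lam" "lam < \<alpha>" and \<gamma>: "\<And>j. j \<ge> 1 \<Longrightarrow> \<gamma> j \<ge> 0"
  shows "(\<Sum>\<zeta>\<in>{1..<N}. fresh_part (Suc l) \<alpha> \<gamma> N (z(Suc l := \<zeta>)) powr (1 / (2 * lam)))
    \<le> (\<Prod>j\<in>{1..l}. 1 + \<gamma> j powr (1 / lam) * (2 * riemann_zeta (\<alpha> / lam))) *
        (\<gamma> (Suc l) powr (1 / lam) * (2 * riemann_zeta (\<alpha> / lam)))"
proof -
  \<comment> \<open>This power turns 2 \<alpha> into \<alpha>/lam and \<gamma>_j^2 into
    \<gamma>_j^(1/lam).\<close>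
  define \<mu> where "\<mu> = 1 / (2 * lam)"
  define a where "a = \<alpha> / lam"
  define c where "c = (\<lambda>j. \<gamma> j powr (1 / lam))"
  have a: "a > 1" using lam by (simp add: a_def)
  have c: "c j \<ge> 0" for j by (simp add: c_def)
  have \<mu>: "0 < \<mu>" "\<mu> \<le> 1" using lam by (auto simp: \<mu>_def field_simps)
  have fw: "freq_weight (2 * \<alpha>) (\<lambda>j. (\<gamma> j)\<^sup>2) (Suc l) k powr \<mu> = freq_weight a c (Suc l) k" for k
  proof -
    have "freq_weight (2 * \<alpha>) (\<lambda>j. (\<gamma> j)\<^sup>2) (Suc l) k powr \<mu>
        = freq_weight (2 * \<alpha> * \<mu>) (\<lambda>j. (\<gamma> j)\<^sup>2 powr \<mu>) (Suc l) k"
      by (rule freq_weight_powr) auto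
    also have "2 * \<alpha> * \<mu> = a" using lam by (simp add: \<mu>_def a_def)
    also have "freq_weight a (\<lambda>j. (\<gamma> j)\<^sup>2 powr \<mu>) (Suc l) k = freq_weight a c (Suc l) k"
      unfolding freq_weight_def
    proof (intro prod.cong refl)
      fix j assume "j \<in> {1..Suc l}"
      hence "\<gamma> j \<ge> 0" using \<gamma> by auto
      hence "(\<gamma> j)\<^sup>2 powr \<mu> = c j"
        using lam by (cases "\<gamma> j = 0") (auto simp: c_def \<mu>_def powr_powr field_simps simp flip: powr_numeral)
      thus "coord_weight a ((\<gamma> j)\<^sup>2 powr \<mu>) (k j) = coord_weight a (c j) (k j)" by simp
    qed
    finally show ?thesis .
  qed
  let ?w = "\<lambda>m. c (Suc l) / \<bar>real_of_int m\<bar> powr a"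
  let ?h = "\<lambda>k. \<Sum>j\<in>{1..l}. k j * int (z j)"
  let ?D = "\<lambda>\<zeta>. {p\<in>int_vecs l \<times> {m. m \<noteq> 0}. int N dvd ?h (fst p) + snd p * int \<zeta>}"
  let ?g = "\<lambda>p. freq_weight a c l (fst p) * ?w (snd p)"
  let ?n = "\<lambda>p. real (card {\<zeta>\<in>{1..<N}. int N dvd ?h (fst p) + snd p * int \<zeta>})"
  have hw: "(?w has_sum (c (Suc l) * (2 * riemann_zeta a))) {m. m \<noteq> 0}"
    by (rule has_sum_nonzero_int[OF a c])
  have hf: "(freq_weight a c l has_sum (\<Prod>j\<in>{1..l}. 1 + c j * (2 * riemann_zeta a))) (int_vecs l)"
    by (rule has_sum_freq_weight[OF a c])
  have f0: "freq_weight a c l k \<ge> 0" for k by (rule freq_weight_nonneg[OF c])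
  have gs: "?g summable_on (int_vecs l \<times> {m. m \<noteq> 0})"
  proof (rule summable_on_SigmaI)
    show "((\<lambda>m. ?g (k, m)) has_sum (freq_weight a c l k * (c (Suc l) * (2 * riemann_zeta a)))) {m. m \<noteq> 0}" for k
      using has_sum_cmult_right[OF hw] by simp
    show "(\<lambda>k. freq_weight a c l k * (c (Suc l) * (2 * riemann_zeta a))) summable_on int_vecs l"
      using hf by (intro summable_on_cmult_left) (rule has_sum_imp_summable)
  qed (use f0 c in auto)
  have bij: "bij_betw (\<lambda>(k, m). k(Suc l := m)) (?D \<zeta>) {k\<in>dual_lattice (Suc l) N (z(Suc l := \<zeta>)). k (Suc l) \<noteq> 0}" for \<zeta>
  proof -
    have "(\<Sum>j\<in>{1..l}. k j * int ((z(Suc l := \<zeta>)) j)) = ?h k" for k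
      by (intro sum.cong) auto
    hence mem: "k(Suc l := m) \<in> dual_lattice (Suc l) N (z(Suc l := \<zeta>)) \<longleftrightarrow> int N dvd ?h k + m * int \<zeta>"
      if "k \<in> int_vecs l" for k m
      using upd_mem_dual_lattice_Suc[OF that, of m N "z(Suc l := \<zeta>)"] by simp
    have "(\<lambda>(k, m). k(Suc l := m)) ` ?D \<zeta> = {k\<in>dual_lattice (Suc l) N (z(Suc l := \<zeta>)). k (Suc l) \<noteq> 0}"
    proof (intro equalityI subsetI)
      fix x assume "x \<in> (\<lambda>(k, m). k(Suc l := m)) ` ?D \<zeta>"
      thus "x \<in> {k\<in>dual_lattice (Suc l) N (z(Suc l := \<zeta>)). k (Suc l) \<noteq> 0}" using mem by auto
    next
      fix x assume x: "x \<in> {k\<in>dual_lattice (Suc l) N (z(Suc l := \<zeta>)). k (Suc l) \<noteq> 0}"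
      hence "x \<in> (\<lambda>(k, m). k(Suc l := m)) ` (int_vecs l \<times> UNIV)"
        unfolding bij_betw_imp_surj_on[OF bij_betw_int_vecs_Suc] by (simp add: mem_dual_lattice_iff)
      then obtain k m where km: "k \<in> int_vecs l" "x = k(Suc l := m)" by auto
      hence "(k, m) \<in> ?D \<zeta>" using x mem[OF km(1)] by auto
      thus "x \<in> (\<lambda>(k, m). k(Suc l := m)) ` ?D \<zeta>" using km by force
    qed
    moreover have "inj_on (\<lambda>(k, m). k(Suc l := m)) (?D \<zeta>)"
      using bij_betw_imp_inj_on[OF bij_betw_int_vecs_Suc] by (rule inj_on_subset) auto
    ultimately show ?thesis by (simp add: bij_betw_def)
  qed
  have gD: "?g summable_on ?D \<zeta>" for \<zeta>
    by (rule summable_on_subset_banach[OF gs]) auto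
  have 1: "fresh_part (Suc l) \<alpha> \<gamma> N (z(Suc l := \<zeta>)) powr \<mu> \<le> infsum ?g (?D \<zeta>)" for \<zeta>
  proof -
    let ?E = "{k\<in>dual_lattice (Suc l) N (z(Suc l := \<zeta>)). k (Suc l) \<noteq> 0}"
    have "fresh_part (Suc l) \<alpha> \<gamma> N (z(Suc l := \<zeta>)) powr \<mu>
        \<le> (\<Sum>\<^sub>\<infinity>k\<in>?E. freq_weight (2 * \<alpha>) (\<lambda>j. (\<gamma> j)\<^sup>2) (Suc l) k powr \<mu>)"
      unfolding fresh_part_def
    proof (rule infsum_powr_le(2)[OF \<mu>])
      show "(\<lambda>k. freq_weight (2 * \<alpha>) (\<lambda>j. (\<gamma> j)\<^sup>2) (Suc l) k powr \<mu>) summable_on ?E"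
        unfolding fw by (rule freq_weight_summable_on[OF a c]) (auto simp: mem_dual_lattice_iff)
    qed (auto intro: freq_weight_nonneg)
    also have "\<dots> = (\<Sum>\<^sub>\<infinity>p\<in>?D \<zeta>. freq_weight a c (Suc l) (case p of (k, m) \<Rightarrow> k(Suc l := m)))"
      unfolding fw by (rule infsum_reindex_bij_betw[OF bij, symmetric])
    also have "\<dots> = infsum ?g (?D \<zeta>)"
      by (intro infsum_cong) (auto simp: freq_weight_Suc coord_weight_def)
    finally show ?thesis .
  qed
  have "(\<Sum>\<zeta>\<in>{1..<N}. fresh_part (Suc l) \<alpha> \<gamma> N (z(Suc l := \<zeta>)) powr \<mu>) \<le> (\<Sum>\<zeta>\<in>{1..<N}. infsum ?g (?D \<zeta>))"
    by (intro sum_mono 1)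
  \<comment> \<open>Extension by zero puts all \<zeta> on one index set, so that the finite sum can
    be moved inside.\<close>
  also have "\<dots> = (\<Sum>\<zeta>\<in>{1..<N}. \<Sum>\<^sub>\<infinity>p\<in>int_vecs l \<times> {m. m \<noteq> 0}. if p \<in> ?D \<zeta> then ?g p else 0)"
    by (intro sum.cong infsum_cong_neutral) auto
  also have "\<dots> = (\<Sum>\<^sub>\<infinity>p\<in>int_vecs l \<times> {m. m \<noteq> 0}. \<Sum>\<zeta>\<in>{1..<N}. if p \<in> ?D \<zeta> then ?g p else 0)"
  proof (rule infsumI[symmetric], rule has_sum_sum, rule has_sum_infsum)
    show "(\<lambda>p. if p \<in> ?D \<zeta> then ?g p else 0) summable_on int_vecs l \<times> {m. m \<noteq> 0}" for \<zeta>
      using gD[of \<zeta>] by (rule summable_on_cong_neutral[THEN iffD1, rotated -1]) auto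
  qed
  also have "\<dots> = (\<Sum>\<^sub>\<infinity>p\<in>int_vecs l \<times> {m. m \<noteq> 0}. ?g p * ?n p)"
    by (intro infsum_cong) (auto simp: mult.commute simp flip: sum.inter_filter)
  also have "\<dots> \<le> (\<Prod>j\<in>{1..l}. 1 + c j * (2 * riemann_zeta a)) * (c (Suc l) * (2 * riemann_zeta a))"
  proof -
    let ?S = "\<lambda>k. \<Sum>\<^sub>\<infinity>m\<in>{m. m \<noteq> 0}. ?w m * ?n (k, m)"
    have S: "((\<lambda>m. ?w m * ?n (k, m)) has_sum ?S k) {m. m \<noteq> 0}" "?S k \<le> c (Suc l) * (2 * riemann_zeta a)" for k
      using infsum_solutions_le[OF N a c, of "Suc l" "?h k"] by (auto intro: has_sum_infsum)
    have S0: "?S k \<ge> 0" for k by (intro infsum_nonneg) (use c in auto)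
    have s1: "((\<lambda>m. ?g (k, m) * ?n (k, m)) has_sum (freq_weight a c l k * ?S k)) {m. m \<noteq> 0}" for k
      using has_sum_cmult_right[OF S(1), of "freq_weight a c l k" k] by (simp add: mult.assoc)
    have Cs: "(\<lambda>k. freq_weight a c l k * (c (Suc l) * (2 * riemann_zeta a))) summable_on int_vecs l"
      using hf by (intro summable_on_cmult_left) (rule has_sum_imp_summable)
    have s2: "(\<lambda>k. freq_weight a c l k * ?S k) summable_on int_vecs l"
      by (rule summable_on_comparison_test[OF Cs]) (use S(2) f0 S0 in \<open>auto intro!: mult_left_mono\<close>)
    have s3: "(\<lambda>p. ?g p * ?n p) summable_on int_vecs l \<times> {m. m \<noteq> 0}"
      by (rule summable_on_SigmaI[OF s1 s2]) (use f0 c in auto)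
    have "(\<Sum>\<^sub>\<infinity>p\<in>int_vecs l \<times> {m. m \<noteq> 0}. ?g p * ?n p) = (\<Sum>\<^sub>\<infinity>k\<in>int_vecs l. freq_weight a c l k * ?S k)"
      by (rule infsumI, rule has_sum_SigmaI[OF s1 _ s3]) (rule has_sum_infsum[OF s2])
    also have "\<dots> \<le> (\<Sum>\<^sub>\<infinity>k\<in>int_vecs l. freq_weight a c l k * (c (Suc l) * (2 * riemann_zeta a)))"
      by (intro infsum_mono s2 Cs mult_left_mono S f0)
    also have "\<dots> = (\<Prod>j\<in>{1..l}. 1 + c j * (2 * riemann_zeta a)) * (c (Suc l) * (2 * riemann_zeta a))"
      by (intro infsumI has_sum_cmult_left hf)
    finally show ?thesis .
  qed
  finally show ?thesis unfolding a_def c_def \<mu>_def .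
qed

text \<open>If \<open>x\<close> sits at position i < q of the sorted list, then the entries from i
  onward, \<open>x\<close> included, have keys at least as large, and there are at least length - q
  + 1 of them.\<close>

lemma card_sort_key_ge:
  fixes f :: "'a::linorder \<Rightarrow> 'b::linorder"
  assumes "x \<in> set (take q (sort_key f xs))" "distinct xs"
  shows "length xs + 1 \<le> card {y\<in>set xs. f x \<le> f y} + q"
proof -
  let ?ys = "sort_key f xs"
  from assms(1) obtain i where i: "i < q" "i < length xs" "?ys ! i = x"
    by (auto simp: in_set_conv_nth)
  have "set (drop i ?ys) \<subseteq> {y\<in>set xs. f x \<le> f y}"
  proof
    fix y assume "y \<in> set (drop i ?ys)"
    then obtain j where j: "j < length xs - i" "y = ?ys ! (i + j)"
      by (auto simp: in_set_conv_nth)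
    have "f (?ys ! i) \<le> f (?ys ! (i + j))"
      using sorted_nth_mono[OF sorted_sort_key[of f xs], of i "i + j"] i j by simp
    moreover have "y \<in> set ?ys" unfolding j(2) by (rule nth_mem) (use j i in simp)
    ultimately show "y \<in> {y\<in>set xs. f x \<le> f y}" using i j by simp
  qed
  hence "card (set (drop i ?ys)) \<le> card {y\<in>set xs. f x \<le> f y}"
    by (rule card_mono[rotated]) simp
  moreover have "card (set (drop i ?ys)) = length xs - i"
    using assms(2) by (subst distinct_card) auto
  ultimately show ?thesis using i by simp
qed

section \<open>Size of the candidate sets and the bound on the criterion\<close>

lemma cbc_candidates_subset: "cbc_candidates \<alpha> \<gamma> N \<tau> l z \<subseteq> {1..<N}"
  unfolding cbc_candidates_def using set_take_subset by force

lemma cbc_candidates_count_le: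
  assumes "0 < \<tau>" "\<tau> < 1" "N \<ge> 2"
  shows "real (nat \<lceil>\<tau> * (real N - 1)\<rceil>) < \<tau> * (real N - 1) + 1"
    and "\<tau> * (real N - 1) \<le> real (nat \<lceil>\<tau> * (real N - 1)\<rceil>)"
    and "nat \<lceil>\<tau> * (real N - 1)\<rceil> \<le> N - 1"
    and "0 < nat \<lceil>\<tau> * (real N - 1)\<rceil>"
proof -
  have 0: "\<tau> * (real N - 1) > 0" using assms by simp
  have 1: "\<tau> * (real N - 1) \<le> 1 * (real N - 1)" using assms by (intro mult_right_mono) auto
  show "real (nat \<lceil>\<tau> * (real N - 1)\<rceil>) < \<tau> * (real N - 1) + 1"
    and "\<tau> * (real N - 1) \<le> real (nat \<lceil>\<tau> * (real N - 1)\<rceil>)"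
    and "0 < nat \<lceil>\<tau> * (real N - 1)\<rceil>"
    using 0 by linarith+
  have "\<tau> * (real N - 1) \<le> real_of_int (int N - 1)" using 1 by simp
  hence "\<lceil>\<tau> * (real N - 1)\<rceil> \<le> int N - 1" by (simp only: ceiling_le_iff)
  thus "nat \<lceil>\<tau> * (real N - 1)\<rceil> \<le> N - 1" by linarith
qed

lemma card_cbc_candidates:
  assumes "0 < \<tau>" "\<tau> < 1" "N \<ge> 2"
  shows "card (cbc_candidates \<alpha> \<gamma> N \<tau> l z) = nat \<lceil>\<tau> * (real N - 1)\<rceil>"
  unfolding cbc_candidates_def using cbc_candidates_count_le[OF assms]
  by (subst distinct_card) auto

lemma cbc_candidates_cong:
  assumes "\<And>j. j \<in> {1..<l} \<Longrightarrow> z j = z' j"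
  shows "cbc_candidates \<alpha> \<gamma> N \<tau> l z = cbc_candidates \<alpha> \<gamma> N \<tau> l z'"
proof -
  have "R_crit l \<alpha> \<gamma> N (z(l := \<zeta>)) = R_crit l \<alpha> \<gamma> N (z'(l := \<zeta>))" for \<zeta>
    by (rule R_crit_cong) (use assms in auto)
  thus ?thesis by (simp add: cbc_candidates_def)
qed

text \<open>The ceiling exceeds \<tau> (N - 1) by less than 1, which the \<open>+ 1\<close> of
  \<open>card_sort_key_ge\<close> absorbs, so the proportion is 1 - \<tau> without a rounding
  loss.\<close>

lemma card_R_crit_ge:
  assumes "0 < \<tau>" "\<tau> < 1" "N \<ge> 2" "z l \<in> cbc_candidates \<alpha> \<gamma> N \<tau> l z"
  shows "(1 - \<tau>) * (real N - 1)
    \<le> real (card {\<zeta>\<in>{1..<N}. R_crit l \<alpha> \<gamma> N z \<le> R_crit l \<alpha> \<gamma> N (z(l := \<zeta>))})"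
proof -
  have "length [1..<N] + 1 \<le> card {\<zeta>\<in>set [1..<N]. R_crit l \<alpha> \<gamma> N (z(l := z l)) \<le> R_crit l \<alpha> \<gamma> N (z(l := \<zeta>))}
      + nat \<lceil>\<tau> * (real N - 1)\<rceil>"
    by (rule card_sort_key_ge) (use assms(4) in \<open>simp_all add: cbc_candidates_def\<close>)
  hence "real N \<le> real (card {\<zeta>\<in>{1..<N}. R_crit l \<alpha> \<gamma> N z \<le> R_crit l \<alpha> \<gamma> N (z(l := \<zeta>))})
      + real (nat \<lceil>\<tau> * (real N - 1)\<rceil>)"
    using assms(3) by simp
  thus ?thesis using cbc_candidates_count_le(1)[OF assms(1-3)] by (simp add: algebra_simps)
qed

text \<open>Multiplication by a unit modulo N does not change the one-dimensional dual lattice, the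
  multiples of N. The prescribed z_1 = 1 is therefore as good as any other choice, and the averaging
  argument covers the first coordinate too.\<close>

lemma R_crit_1_unit:
  assumes "prime N" "\<zeta> \<in> {1..<N}" "z 1 \<in> {1..<N}"
  shows "R_crit 1 \<alpha> \<gamma> N (z(1 := \<zeta>)) = R_crit 1 \<alpha> \<gamma> N z"
proof -
  have "int N dvd k * int x \<longleftrightarrow> int N dvd k" if "x \<in> {1..<N}" for k :: int and x
  proof -
    have "\<not> N dvd x" using that by (auto dest: dvd_imp_le)
    thus ?thesis using assms(1) prime_dvd_mult_iff[of "int N" k "int x"] by simp
  qed
  hence "dual_lattice 1 N (z(1 := \<zeta>)) = dual_lattice 1 N z"
    using assms by (auto simp: mem_dual_lattice_iff)
  thus ?thesis by (simp add: R_crit_def)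
qed

lemma R_crit_nonneg: "R_crit l \<alpha> \<gamma> N z \<ge> 0"
  unfolding R_crit_def by (intro infsum_nonneg) auto

text \<open>Induction over the prefixes of one admissible vector. The fresh part is bounded by
  averaging over the candidates that are no better than the chosen one; subadditivity of the power
  then adds P t to P - 1, which is P (1 + t) - 1, the next product minus 1.\<close>

lemma R_crit_powr_le:
  fixes N :: nat
  assumes N: "prime N" and lam: "1 / 2 \<le> lam" "lam < \<alpha>" and \<gamma>: "\<And>j. j \<ge> 1 \<Longrightarrow> \<gamma> j \<ge> 0"
    and \<tau>: "0 < \<tau>" "\<tau> < 1" and z: "z \<in> cbc_vectors s \<alpha> \<gamma> N \<tau>" and l: "l \<le> s"
  shows "(1 - \<tau>) * (real N - 1) * R_crit l \<alpha> \<gamma> N z powr (1 / (2 * lam))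
    \<le> (\<Prod>j\<in>{1..l}. 1 + \<gamma> j powr (1 / lam) * (2 * riemann_zeta (\<alpha> / lam))) - 1"
  using l
proof (induction l)
  case 0
  have "dual_lattice 0 N z - {\<lambda>j\<in>{1..0}. 0} = {}"
    by (auto simp: mem_dual_lattice_iff int_vecs_def PiE_def extensional_def restrict_def)
  hence "R_crit 0 \<alpha> \<gamma> N z = 0" by (simp only: R_crit_def infsum_empty)
  thus ?case by simp
next
  case (Suc l)
  let ?\<mu> = "1 / (2 * lam)"
  let ?P = "\<Prod>j\<in>{1..l}. 1 + \<gamma> j powr (1 / lam) * (2 * riemann_zeta (\<alpha> / lam))"
  let ?t = "\<gamma> (Suc l) powr (1 / lam) * (2 * riemann_zeta (\<alpha> / lam))"
  let ?R = "R_crit (Suc l) \<alpha> \<gamma> N"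
  let ?\<theta> = "fresh_part (Suc l) \<alpha> \<gamma> N"
  have N2: "N \<ge> 2" using N prime_ge_2_nat by blast
  have \<alpha>: "2 * \<alpha> > 1" and \<mu>: "0 < ?\<mu>" "?\<mu> \<le> 1" using lam by auto
  have zs: "z j \<in> {1..<N}" if "j \<in> {1..s}" for j
    using z that N2 unfolding cbc_vectors_def by (fastforce simp: PiE_iff)
  let ?G = "{\<zeta>\<in>{1..<N}. ?R z \<le> ?R (z(Suc l := \<zeta>))}"
  have G: "(1 - \<tau>) * (real N - 1) \<le> real (card ?G)"
  proof (cases "l = 0")
    case True
    have "?G = {1..<N}" using R_crit_1_unit[OF N, of _ z \<alpha> \<gamma>] zs[of 1] Suc.prems True by auto
    hence "real (card ?G) = real N - 1" using N2 by simp
    moreover have "(1 - \<tau>) * (real N - 1) \<le> 1 * (real N - 1)"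
      using \<tau> N2 by (intro mult_right_mono) auto
    ultimately show ?thesis by simp
  next
    case False
    thus ?thesis using z Suc.prems \<tau> N2
      by (intro card_R_crit_ge) (auto simp: cbc_vectors_def)
  qed
  have RS: "?R (z(Suc l := \<zeta>)) = R_crit l \<alpha> \<gamma> N z + ?\<theta> (z(Suc l := \<zeta>))" for \<zeta>
    using R_crit_Suc[OF \<alpha>, of l \<gamma> N "z(Suc l := \<zeta>)"] R_crit_cong[of l "z(Suc l := \<zeta>)" z \<alpha> \<gamma> N] by simp
  \<comment> \<open>The common summand \<open>R_crit l \<alpha> \<gamma> N z\<close> cancels from
    the comparison.\<close>
  have \<theta>le: "?\<theta> z \<le> ?\<theta> (z(Suc l := \<zeta>))" if "\<zeta> \<in> ?G" for \<zeta>
    using that RS[of \<zeta>] R_crit_Suc[OF \<alpha>, of l \<gamma> N z] by simp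
  have "(1 - \<tau>) * (real N - 1) * ?\<theta> z powr ?\<mu> \<le> real (card ?G) * ?\<theta> z powr ?\<mu>"
    by (intro mult_right_mono G) auto
  also have "\<dots> = (\<Sum>\<zeta>\<in>?G. ?\<theta> z powr ?\<mu>)" by simp
  also have "\<dots> \<le> (\<Sum>\<zeta>\<in>?G. ?\<theta> (z(Suc l := \<zeta>)) powr ?\<mu>)"
    using \<mu> by (intro sum_mono powr_mono2 \<theta>le fresh_part_nonneg) auto
  also have "\<dots> \<le> (\<Sum>\<zeta>\<in>{1..<N}. ?\<theta> (z(Suc l := \<zeta>)) powr ?\<mu>)"
    by (intro sum_mono2) auto
  also have "\<dots> \<le> ?P * ?t" by (rule sum_fresh_part_powr_le[OF N lam \<gamma>])
  finally have \<theta>: "(1 - \<tau>) * (real N - 1) * ?\<theta> z powr ?\<mu> \<le> ?P * ?t" .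
  have "?R z powr ?\<mu> \<le> R_crit l \<alpha> \<gamma> N z powr ?\<mu> + ?\<theta> z powr ?\<mu>"
    unfolding R_crit_Suc[OF \<alpha>] by (rule powr_add_le[OF \<mu> R_crit_nonneg fresh_part_nonneg])
  hence "(1 - \<tau>) * (real N - 1) * ?R z powr ?\<mu>
      \<le> (1 - \<tau>) * (real N - 1) * (R_crit l \<alpha> \<gamma> N z powr ?\<mu> + ?\<theta> z powr ?\<mu>)"
    using \<tau> N2 by (intro mult_left_mono) auto
  also have "\<dots> = (1 - \<tau>) * (real N - 1) * R_crit l \<alpha> \<gamma> N z powr ?\<mu> + (1 - \<tau>) * (real N - 1) * ?\<theta> z powr ?\<mu>"
    by (rule distrib_left)
  also have "\<dots> \<le> (?P - 1) + ?P * ?t"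
    using Suc \<theta> by (intro add_mono) auto
  also have "\<dots> = (\<Prod>j\<in>{1..Suc l}. 1 + \<gamma> j powr (1 / lam) * (2 * riemann_zeta (\<alpha> / lam))) - 1"
    by (simp add: algebra_simps)
  finally show ?case .
qed

section \<open>Counting admissible generating vectors\<close>

lemma finite_cbc_vectors [simp]: "finite (cbc_vectors s \<alpha> \<gamma> N \<tau>)"
  by (rule finite_subset[of _ "{1..s} \<rightarrow>\<^sub>E {1..N - 1}"]) (auto simp: cbc_vectors_def intro!: finite_PiE)

text \<open>The candidates at stage l see only the entries below l, so an admissible vector is a
  shorter admissible vector with one candidate appended. With \<open>s \<ge> 1\<close> the fixed
  entry z_1 belongs to the shorter vector.\<close>

lemma cbc_vectors_Suc:
  assumes "s \<ge> 1"
  shows "cbc_vectors (Suc s) \<alpha> \<gamma> N \<tau> =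
    (\<lambda>(z, \<zeta>). z(Suc s := \<zeta>)) ` (SIGMA z:cbc_vectors s \<alpha> \<gamma> N \<tau>. cbc_candidates \<alpha> \<gamma> N \<tau> (Suc s) z)"
    (is "_ = ?h ` ?S")
proof (intro equalityI subsetI)
  have eq: "{1..Suc s} = insert (Suc s) {1..s}" by auto
  fix z assume z: "z \<in> cbc_vectors (Suc s) \<alpha> \<gamma> N \<tau>"
  define y where "y = restrict z {1..s}"
  have zy: "z = y(Suc s := z (Suc s))"
    using z by (auto simp: y_def cbc_vectors_def PiE_def extensional_def restrict_def fun_eq_iff)
  have zP: "z \<in> {1..Suc s} \<rightarrow>\<^sub>E {1..N - 1}" "z 1 = 1"
    and zc: "\<And>l. l \<in> {2..Suc s} \<Longrightarrow> z l \<in> cbc_candidates \<alpha> \<gamma> N \<tau> l z"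
    using z by (auto simp: cbc_vectors_def)
  have yc: "cbc_candidates \<alpha> \<gamma> N \<tau> l z = cbc_candidates \<alpha> \<gamma> N \<tau> l y" if "l \<le> Suc s" for l
    by (rule cbc_candidates_cong) (use that in \<open>auto simp: y_def\<close>)
  have "y \<in> cbc_vectors s \<alpha> \<gamma> N \<tau>"
    unfolding cbc_vectors_def
  proof (intro CollectI conjI ballI)
    show "y \<in> {1..s} \<rightarrow>\<^sub>E {1..N - 1}" using zP unfolding y_def by (auto simp: PiE_iff)
    show "y 1 = 1" using zP assms by (simp add: y_def)
    fix l assume l: "l \<in> {2..s}"
    thus "y l \<in> cbc_candidates \<alpha> \<gamma> N \<tau> l y" using zc[of l] yc[of l] by (simp add: y_def)
  qed
  moreover have "z (Suc s) \<in> cbc_candidates \<alpha> \<gamma> N \<tau> (Suc s) y"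
    using zc[of "Suc s"] yc[of "Suc s"] assms by simp
  ultimately have "(y, z (Suc s)) \<in> ?S" by simp
  moreover have "z = ?h (y, z (Suc s))" using zy by simp
  ultimately show "z \<in> ?h ` ?S" by (rule rev_image_eqI)
next
  fix x assume "x \<in> ?h ` ?S"
  then obtain z \<zeta> where x: "x = z(Suc s := \<zeta>)" "z \<in> cbc_vectors s \<alpha> \<gamma> N \<tau>"
    "\<zeta> \<in> cbc_candidates \<alpha> \<gamma> N \<tau> (Suc s) z" by auto
  have \<zeta>: "\<zeta> \<in> {1..<N}" using x(3) cbc_candidates_subset by blast
  have xc: "cbc_candidates \<alpha> \<gamma> N \<tau> l x = cbc_candidates \<alpha> \<gamma> N \<tau> l z" if "l \<le> Suc s" for l
    by (rule cbc_candidates_cong) (use that x in auto)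
  show "x \<in> cbc_vectors (Suc s) \<alpha> \<gamma> N \<tau>"
    unfolding cbc_vectors_def
  proof (intro CollectI conjI ballI)
    have "z \<in> {1..s} \<rightarrow>\<^sub>E {1..N - 1}" using x(2) by (simp add: cbc_vectors_def)
    thus "x \<in> {1..Suc s} \<rightarrow>\<^sub>E {1..N - 1}" using \<zeta> unfolding x(1)
      by (auto simp: PiE_iff extensional_def)
    show "x 1 = 1" using x assms by (simp add: cbc_vectors_def)
    fix l assume l: "l \<in> {2..Suc s}"
    show "x l \<in> cbc_candidates \<alpha> \<gamma> N \<tau> l x"
    proof (cases "l = Suc s")
      case True
      thus ?thesis using x xc[of l] by simp
    next
      case False
      thus ?thesis using x l xc[of l] by (simp add: cbc_vectors_def)
    qed
  qed
qed

lemma inj_on_upd_cbc_vectors: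
  "inj_on (\<lambda>(z, \<zeta>). z(Suc s := \<zeta>)) (SIGMA z:cbc_vectors s \<alpha> \<gamma> N \<tau>. F z)"
proof -
  have "inj_on (\<lambda>(z, \<zeta>). z(Suc s := \<zeta>)) (({1..s} \<rightarrow>\<^sub>E (UNIV :: nat set)) \<times> UNIV)"
    by (rule inj_combinator') simp
  thus ?thesis by (rule inj_on_subset) (auto simp: cbc_vectors_def PiE_iff extensional_def)
qed

text \<open>All candidate sets have the same size q, so the last coordinate can be split off. If N
  does not divide its frequency, at most one of the q candidates completes each prefix; if N does,
  the last term drops out of the congruence and \<open>j\<close> lies among the earlier coordinates.
  In dimension 1, z_1 = 1 admits no solution at all.\<close>

lemma card_cbc_vectors_dual_le:
  fixes N :: nat
  assumes N: "prime N" and \<tau>: "0 < \<tau>" "\<tau> < 1" and s: "s \<ge> 1"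
    and j: "j \<in> {1..s}" "\<not> int N dvd k j"
  shows "card {z\<in>cbc_vectors s \<alpha> \<gamma> N \<tau>. int N dvd (\<Sum>i\<in>{1..s}. k i * int (z i))}
           * nat \<lceil>\<tau> * (real N - 1)\<rceil> \<le> card (cbc_vectors s \<alpha> \<gamma> N \<tau>)"
  using s j
proof (induction s arbitrary: j rule: nat_induct_at_least)
  case base
  hence "{z\<in>cbc_vectors 1 \<alpha> \<gamma> N \<tau>. int N dvd (\<Sum>i\<in>{1..1}. k i * int (z i))} = {}"
    by (auto simp: cbc_vectors_def)
  thus ?case by (simp only: card.empty)
next
  case (Suc s)
  let ?q = "nat \<lceil>\<tau> * (real N - 1)\<rceil>"
  let ?Z = "\<lambda>s. cbc_vectors s \<alpha> \<gamma> N \<tau>"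
  let ?C = "\<lambda>z. cbc_candidates \<alpha> \<gamma> N \<tau> (Suc s) z"
  let ?h = "\<lambda>(z, \<zeta>). z(Suc s := \<zeta>) :: nat \<Rightarrow> nat"
  let ?d = "\<lambda>z. \<Sum>i\<in>{1..s}. k i * int (z i)"
  have N2: "N \<ge> 2" using N prime_ge_2_nat by blast
  have cC: "card (?C z) = ?q" for z by (rule card_cbc_candidates[OF \<tau> N2])
  have fC: "finite (?C z)" for z by (simp add: cbc_candidates_def)
  have cZ: "card (?Z (Suc s)) = card (?Z s) * ?q"
    unfolding cbc_vectors_Suc[OF Suc.hyps]
    by (subst card_image[OF inj_on_upd_cbc_vectors], subst card_SigmaI) (simp_all add: fC cC)
  have d: "(\<Sum>i\<in>{1..Suc s}. k i * int ((z(Suc s := \<zeta>)) i)) = ?d z + k (Suc s) * int \<zeta>" for z \<zeta>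
  proof -
    have "(\<Sum>i\<in>{1..s}. k i * int ((z(Suc s := \<zeta>)) i)) = ?d z" by (intro sum.cong) auto
    thus ?thesis by simp
  qed
  have "{z\<in>?Z (Suc s). int N dvd (\<Sum>i\<in>{1..Suc s}. k i * int (z i))} =
      ?h ` (SIGMA z:?Z s. {\<zeta>\<in>?C z. int N dvd ?d z + k (Suc s) * int \<zeta>})"
    unfolding cbc_vectors_Suc[OF Suc.hyps] using d by (auto simp: image_iff)
  hence cD: "card {z\<in>?Z (Suc s). int N dvd (\<Sum>i\<in>{1..Suc s}. k i * int (z i))} =
      (\<Sum>z\<in>?Z s. card {\<zeta>\<in>?C z. int N dvd ?d z + k (Suc s) * int \<zeta>})"
    by (simp only:, subst card_image[OF inj_on_upd_cbc_vectors], subst card_SigmaI) (simp_all add: fC)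
  show ?case
  proof (cases "int N dvd k (Suc s)")
    case False
    have "card {\<zeta>\<in>?C z. int N dvd ?d z + k (Suc s) * int \<zeta>} \<le> 1" for z
    proof -
      have "card {\<zeta>\<in>?C z. int N dvd ?d z + k (Suc s) * int \<zeta>}
          \<le> card {\<zeta>\<in>{1..<N}. int N dvd ?d z + k (Suc s) * int \<zeta>}"
        by (rule card_mono) (use cbc_candidates_subset[of \<alpha> \<gamma> N \<tau> "Suc s" z] in auto)
      also have "\<dots> \<le> 1" by (rule card_solutions_le[OF N False])
      finally show ?thesis .
    qed
    hence "(\<Sum>z\<in>?Z s. card {\<zeta>\<in>?C z. int N dvd ?d z + k (Suc s) * int \<zeta>}) \<le> (\<Sum>z\<in>?Z s. 1)"
      by (intro sum_mono)
    thus ?thesis unfolding cD cZ by (intro mult_right_mono) auto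
  next
    case True
    hence js: "j \<in> {1..s}" using Suc.prems by (cases "j = Suc s") auto
    have "card {\<zeta>\<in>?C z. int N dvd ?d z + k (Suc s) * int \<zeta>} = (if int N dvd ?d z then ?q else 0)" for z
      using True cC[of z] by (simp add: dvd_add_left_iff)
    hence "(\<Sum>z\<in>?Z s. card {\<zeta>\<in>?C z. int N dvd ?d z + k (Suc s) * int \<zeta>}) =
        (\<Sum>z\<in>?Z s. if int N dvd ?d z then ?q else 0)" by (intro sum.cong) auto
    also have "\<dots> = card {z\<in>?Z s. int N dvd ?d z} * ?q"
      by (subst sum.inter_filter[symmetric]) simp_all
    finally show ?thesis unfolding cD cZ using Suc.IH[OF js Suc.prems(2)] by (simp only: mult_le_mono)
  qed
qed

section \<open>The mean square error over random shifts\<close>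

lemma space_lborel_dim: "space (lborel_dim s) = {1..s} \<rightarrow>\<^sub>E UNIV"
  by (simp add: lborel_dim_def space_PiM)

lemma indicator_cube:
  "x \<in> space (lborel_dim s) \<Longrightarrow> indicator (cube s) x = (\<Prod>j\<in>{1..s}. indicator {0..<1} (x j) :: real)"
  by (auto simp: space_lborel_dim cube_def indicator_def PiE_iff)

lemma cube_sets [measurable]: "cube s \<in> sets (lborel_dim s)"
  unfolding cube_def lborel_dim_def by (intro sets_PiM_I_finite) auto

lemma emeasure_cube: "emeasure (lborel_dim s) (cube s) = 1"
proof -
  interpret product_sigma_finite "\<lambda>_. lborel :: real measure" by standard
  show ?thesis unfolding lborel_dim_def cube_def
    by (subst emeasure_PiM) auto
qed

lemma borel_measurable_fourier_char [measurable]: "fourier_char s k \<in> borel_measurable (lborel_dim s)"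
proof -
  have "(\<lambda>x. 2 * pi * (\<Sum>j\<in>{1..s}. real_of_int (k j) * x j)) \<in> borel_measurable (lborel_dim s)"
    unfolding lborel_dim_def by measurable
  hence "(\<lambda>x. cis (2 * pi * (\<Sum>j\<in>{1..s}. real_of_int (k j) * x j))) \<in> borel_measurable (lborel_dim s)"
    by (intro borel_measurable_continuous_on[where f = cis]) (auto intro: continuous_on_cis continuous_on_id)
  moreover have "fourier_char s k = (\<lambda>x. cis (2 * pi * (\<Sum>j\<in>{1..s}. real_of_int (k j) * x j)))"
    by (simp add: fun_eq_iff fourier_char_def)
  ultimately show ?thesis by (simp only:)
qed

lemma borel_measurable_cnj_fourier_char [measurable]:
  "(\<lambda>x. cnj (fourier_char s k x)) \<in> borel_measurable (lborel_dim s)"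
  by (rule borel_measurable_continuous_on[OF _ borel_measurable_fourier_char])
     (intro continuous_intros)

lemma norm_fourier_char [simp]: "norm (fourier_char s k x) = 1"
  by (simp add: fourier_char_def)

lemma fourier_char_mult_cnj:
  "fourier_char s k x * cnj (fourier_char s l x) = (\<Prod>j\<in>{1..s}. cis (2 * pi * real_of_int (k j - l j) * x j))"
proof -
  have "fourier_char s k x * cnj (fourier_char s l x)
      = cis (\<Sum>j\<in>{1..s}. 2 * pi * real_of_int (k j - l j) * x j)"
    by (simp add: fourier_char_def cis_cnj cis_mult sum_distrib_left sum_subtractf ring_distribs mult_ac)
  also have "\<dots> = (\<Prod>j\<in>{1..s}. cis (2 * pi * real_of_int (k j - l j) * x j))"
    by (induction s) (simp_all add: cis_mult[symmetric])
  finally show ?thesis .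
qed

lemma integral_cis_unit_interval:
  "integrable lborel (\<lambda>x. indicator {0..<1} x *\<^sub>R cis (2 * pi * real_of_int m * x))"
  "(LINT x|lborel. indicator {0..<1} x *\<^sub>R cis (2 * pi * real_of_int m * x)) = (if m = 0 then 1 else 0)"
proof -
  let ?f = "\<lambda>x. cis (2 * pi * real_of_int m * x)"
  have cont: "continuous_on A ?f" for A by (intro continuous_on_cis continuous_intros)
  have *: "has_bochner_integral lborel (\<lambda>x. indicator {0..1} x *\<^sub>R ?f x) (if m = 0 then 1 else 0)"
  proof (cases "m = 0")
    case True
    have "has_bochner_integral lborel (\<lambda>x. indicator {0..1::real} x *\<^sub>R (1::complex)) 1"
      using has_bochner_integral_real_indicator[of "{0..1::real}" lborel]
      by (intro has_bochner_integral_scaleR_left[of _ _ _ 1, simplified]) simp_all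
    thus ?thesis using True by simp
  next
    case False
    define F where "F = (\<lambda>x. ?f x / (2 * pi * real_of_int m * \<i>))"
    have "(F has_vector_derivative ?f x) (at x within {0..1})" for x
    proof -
      let ?c = "2 * pi * real_of_int m * \<i>"
      have "((\<lambda>z. exp (?c * z) / ?c) has_field_derivative exp (?c * of_real x)) (at (of_real x))"
        using False by (auto intro!: derivative_eq_intros)
      hence "((\<lambda>x. exp (?c * of_real x) / ?c) has_vector_derivative exp (?c * of_real x)) (at x within {0..1})"
        by (rule has_vector_derivative_real_field)
      thus ?thesis by (simp add: F_def cis_conv_exp mult_ac)
    qed
    hence "has_bochner_integral lborel (\<lambda>x. indicator {0..1} x *\<^sub>R ?f x) (F 1 - F 0)"
      by (intro has_bochner_integral_FTC_Icc cont) auto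
    moreover have "cis (2 * pi * real_of_int m) = 1" by (rule cis_multiple_2pi) auto
    hence "F 1 - F 0 = 0" by (simp add: F_def)
    ultimately show ?thesis using False by simp
  qed
  \<comment> \<open>The fundamental theorem was applied on the closed interval; the endpoint 1 is a
    null set.\<close>
  have ae: "AE x in lborel. indicator {0..1} x *\<^sub>R ?f x = indicator {0..<1} x *\<^sub>R ?f x"
    using AE_lborel_singleton[of "1::real"] by eventually_elim (auto simp: indicator_def)
  have "has_bochner_integral lborel (\<lambda>x. indicator {0..<1} x *\<^sub>R ?f x) (if m = 0 then 1 else 0)"
    using * has_bochner_integral_cong_AE[OF _ _ ae] borel_measurable_continuous_onI[OF cont] by simp
  thus "integrable lborel (\<lambda>x. indicator {0..<1} x *\<^sub>R ?f x)"
    "(LINT x|lborel. indicator {0..<1} x *\<^sub>R ?f x) = (if m = 0 then 1 else 0)"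
    by (auto simp: has_bochner_integral_iff)
qed

lemma fourier_char_orthonormal:
  assumes "k \<in> int_vecs s" "l \<in> int_vecs s"
  shows "(LINT x:cube s|lborel_dim s. fourier_char s k x * cnj (fourier_char s l x)) = (if k = l then 1 else 0)"
proof -
  interpret product_sigma_finite "\<lambda>_. lborel :: real measure" by standard
  have "(LINT x:cube s|lborel_dim s. fourier_char s k x * cnj (fourier_char s l x))
      = (LINT x|lborel_dim s. (\<Prod>j\<in>{1..s}. (indicator {0..<1} (x j) *\<^sub>R cis (2 * pi * real_of_int (k j - l j) * x j))))"
    unfolding set_lebesgue_integral_def
    by (intro Bochner_Integration.integral_cong refl)
       (simp add: indicator_cube fourier_char_mult_cnj scaleR_conv_of_real prod.distrib)
  also have "\<dots> = (\<Prod>j\<in>{1..s}. if k j - l j = 0 then 1 else 0)"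
    unfolding lborel_dim_def
    by (subst product_integral_prod) (simp_all only: finite_atLeastAtMost integral_cis_unit_interval)
  also have "\<dots> = (if k = l then 1 else 0)"
  proof (cases "k = l")
    case False
    then obtain j where "j \<in> {1..s}" "k j \<noteq> l j"
      using assms PiE_ext[of k "{1..s}" "\<lambda>_. UNIV" l] by (auto simp: int_vecs_def)
    hence "(\<Prod>j\<in>{1..s}. if k j - l j = 0 then 1 else (0::complex)) = 0"
      by (intro prod_zero) auto
    thus ?thesis using False by simp
  qed simp
  finally show ?thesis .
qed

lemma set_integrable_cube:
  fixes f :: "(nat \<Rightarrow> real) \<Rightarrow> 'a::{banach, second_countable_topology}"
  assumes "f \<in> borel_measurable (lborel_dim s)" "\<And>x. x \<in> cube s \<Longrightarrow> norm (f x) \<le> B"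
  shows "set_integrable (lborel_dim s) (cube s) f"
proof -
  have "set_integrable (lborel_dim s) (cube s) (\<lambda>_. B)"
    unfolding set_integrable_def
    by (intro integrable_scaleR_left integrable_real_indicator) (simp_all add: emeasure_cube)
  thus ?thesis
    by (rule set_integrable_bound) (use assms in \<open>auto simp: set_borel_measurable_def\<close>, force)
qed

lemma integral_norm_trig_poly:
  fixes c :: "(nat \<Rightarrow> int) \<Rightarrow> complex"
  assumes F: "finite F" "F \<subseteq> int_vecs s"
  shows "(LINT x:cube s|lborel_dim s. (norm (\<Sum>k\<in>F. c k * fourier_char s k x))\<^sup>2) = (\<Sum>k\<in>F. (norm (c k))\<^sup>2)"
proof -
  let ?e = "fourier_char s"
  have int: "set_integrable (lborel_dim s) (cube s) (\<lambda>x. (c k * cnj (c l)) * (?e k x * cnj (?e l x)))" for k l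
    by (rule set_integrable_cube[where B = "norm (c k * cnj (c l))"]) (auto simp: norm_mult)
  have "complex_of_real (LINT x:cube s|lborel_dim s. (norm (\<Sum>k\<in>F. c k * ?e k x))\<^sup>2)
      = (LINT x:cube s|lborel_dim s. complex_of_real ((norm (\<Sum>k\<in>F. c k * ?e k x))\<^sup>2))"
    by (rule set_integral_complex_of_real[symmetric])
  also have "\<dots> = (LINT x:cube s|lborel_dim s. \<Sum>k\<in>F. \<Sum>l\<in>F. (c k * cnj (c l)) * (?e k x * cnj (?e l x)))"
  proof -
    have "complex_of_real ((norm (\<Sum>k\<in>F. c k * ?e k x))\<^sup>2)
        = (\<Sum>k\<in>F. \<Sum>l\<in>F. (c k * cnj (c l)) * (?e k x * cnj (?e l x)))" for x
      unfolding complex_norm_square cnj_sum complex_cnj_mult sum_product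
      by (intro sum.cong refl) (simp add: mult_ac)
    thus ?thesis by (simp only:)
  qed
  also have "\<dots> = (\<Sum>k\<in>F. \<Sum>l\<in>F. LINT x:cube s|lborel_dim s. (c k * cnj (c l)) * (?e k x * cnj (?e l x)))"
  proof -
    have int': "integrable (lborel_dim s) (\<lambda>x. indicator (cube s) x *\<^sub>R ((c k * cnj (c l)) * (?e k x * cnj (?e l x))))" for k l
      using int[of k l] by (simp only: set_integrable_def)
    show ?thesis
      unfolding set_lebesgue_integral_def scaleR_sum_right
      by (simp only: Bochner_Integration.integral_sum Bochner_Integration.integrable_sum int')
  qed
  also have "\<dots> = (\<Sum>k\<in>F. \<Sum>l\<in>F. (c k * cnj (c l)) * (if k = l then 1 else 0))"
    using F fourier_char_orthonormal by (intro sum.cong refl) (subst set_integral_mult_right, auto simp: subset_iff)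
  also have "\<dots> = (\<Sum>k\<in>F. c k * cnj (c k))"
    using F by (intro sum.cong refl) (simp add: if_distrib cong: if_cong)
  also have "\<dots> = complex_of_real (\<Sum>k\<in>F. (norm (c k))\<^sup>2)"
    by (simp only: of_real_sum complex_norm_square)
  finally show ?thesis by (simp only: of_real_eq_iff)
qed


section \<open>The shifted lattice rule applied to Fourier series\<close>

lemma shifted_lattice_point_in_cube: "shifted_lattice_point s N z \<Delta> n \<in> cube s"
  by (auto simp: shifted_lattice_point_def cube_def frac_lt_1)

text \<open>Taking fractional parts changes the argument of \<open>cis\<close> by 2 pi times an
  integer. What remains is the character at the shift times the n-th power of an N-th root of
  unity.\<close>

lemma fourier_char_shifted_lattice_point:
  "fourier_char s k (shifted_lattice_point s N z \<Delta> n) =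
     cis (2 * pi * real_of_int (\<Sum>j\<in>{1..s}. k j * int (z j)) / real N) ^ n * fourier_char s k \<Delta>"
proof -
  define h where "h = (\<Sum>j\<in>{1..s}. k j * int (z j))"
  define y where "y = (\<lambda>j. real n * real (z j) / real N + \<Delta> j)"
  define m where "m = (\<Sum>j\<in>{1..s}. k j * \<lfloor>y j\<rfloor>)"
  have "(\<Sum>j\<in>{1..s}. real_of_int (k j) * shifted_lattice_point s N z \<Delta> n j)
      = (\<Sum>j\<in>{1..s}. real_of_int (k j) * (y j - real_of_int \<lfloor>y j\<rfloor>))"
    by (intro sum.cong) (auto simp: shifted_lattice_point_def y_def frac_def)
  also have "\<dots> = (\<Sum>j\<in>{1..s}. real_of_int (k j) * y j) - real_of_int m"
    by (simp add: m_def sum_subtractf algebra_simps)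
  also have "(\<Sum>j\<in>{1..s}. real_of_int (k j) * y j)
      = real n * (real_of_int h / real N) + (\<Sum>j\<in>{1..s}. real_of_int (k j) * \<Delta> j)"
    by (simp add: y_def h_def sum.distrib sum_distrib_left sum_divide_distrib algebra_simps)
  finally have eq: "(\<Sum>j\<in>{1..s}. real_of_int (k j) * shifted_lattice_point s N z \<Delta> n j)
      = real n * (real_of_int h / real N) + (\<Sum>j\<in>{1..s}. real_of_int (k j) * \<Delta> j) - real_of_int m" .
  have "fourier_char s k (shifted_lattice_point s N z \<Delta> n)
      = cis (real n * (2 * pi * real_of_int h / real N) + 2 * pi * (\<Sum>j\<in>{1..s}. real_of_int (k j) * \<Delta> j) + 2 * pi * real_of_int (- m))"
    unfolding fourier_char_def eq by (rule arg_cong[where f = cis]) (simp add: algebra_simps)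
  also have "\<dots> = cis (2 * pi * real_of_int h / real N) ^ n * fourier_char s k \<Delta> * cis (2 * pi * real_of_int (- m))"
    by (simp only: cis_mult[symmetric] Complex.DeMoivre[symmetric] fourier_char_def)
  also have "cis (2 * pi * real_of_int (- m)) = 1" by (rule cis_multiple_2pi) auto
  finally show ?thesis by (simp add: h_def)
qed

lemma sum_powers_root_of_unity:
  assumes "N > 0"
  shows "(\<Sum>n<N. cis (2 * pi * real_of_int h / real N) ^ n) = (if int N dvd h then of_nat N else 0)"
proof -
  let ?w = "cis (2 * pi * real_of_int h / real N)"
  have "?w = 1 \<longleftrightarrow> int N dvd h"
  proof
    assume "int N dvd h"
    then obtain m where "h = int N * m" by (elim dvdE)
    hence "2 * pi * real_of_int h / real N = 2 * pi * real_of_int m" using assms by simp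
    thus "?w = 1" using cis_multiple_2pi[of "real_of_int m"] by simp
  next
    assume "?w = 1"
    hence "cos (2 * pi * real_of_int h / real N) = 1" by (simp add: complex_eq_iff)
    then obtain m :: int where "2 * pi * real_of_int h / real N = of_int m * 2 * pi"
      using cos_one_2pi_int by blast
    hence "real_of_int h = real_of_int (m * int N)" using assms by (simp add: field_simps)
    hence "h = m * int N" by (simp only: of_int_eq_iff)
    thus "int N dvd h" by simp
  qed
  moreover have "?w ^ N = 1"
  proof -
    have "?w ^ N = cis (2 * pi * real_of_int h)" unfolding Complex.DeMoivre using assms by simp
    thus ?thesis using cis_multiple_2pi[of "real_of_int h"] by simp
  qed
  ultimately show ?thesis by (simp add: sum_gp_strict)
qed

text \<open>Averaging over n multiplies each term by the mean of the powers of a root of unity,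
  which is 1 on the dual lattice and 0 off it. Since the shifted points are reduced into the cube,
  the pointwise series applies for every \<Delta>, also outside the cube.\<close>

lemma shifted_lattice_rule_fourier:
  fixes \<Delta> :: "nat \<Rightarrow> real"
  assumes f: "f \<in> korobov_space s \<alpha> \<gamma>" and N: "N > 0"
  shows "((\<lambda>k. fourier_coeff s f k * fourier_char s k \<Delta>) has_sum
           complex_of_real (shifted_lattice_rule s N z \<Delta> f)) {k\<in>int_vecs s. int N dvd (\<Sum>j\<in>{1..s}. k j * int (z j))}"
proof -
  let ?c = "fourier_coeff s f" and ?e = "fourier_char s"
  let ?h = "\<lambda>k. \<Sum>j\<in>{1..s}. k j * int (z j)"
  let ?x = "shifted_lattice_point s N z \<Delta>"
  let ?w = "\<lambda>k. cis (2 * pi * real_of_int (?h k) / real N)"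
  have abs: "(\<lambda>k. norm (?c k)) summable_on int_vecs s"
    and ser: "\<And>x. x \<in> cube s \<Longrightarrow> complex_of_real (f x) = (\<Sum>\<^sub>\<infinity>k\<in>int_vecs s. ?c k * ?e k x)"
    using f by (auto simp: korobov_space_def)
  have hs: "((\<lambda>k. ?c k * ?e k x) has_sum complex_of_real (f x)) (int_vecs s)" if "x \<in> cube s" for x
    unfolding ser[OF that] by (rule has_sum_infsum, rule abs_summable_summable) (use abs in \<open>simp add: norm_mult\<close>)
  have "((\<lambda>k. \<Sum>n<N. ?c k * ?e k (?x n)) has_sum (\<Sum>n<N. complex_of_real (f (?x n)))) (int_vecs s)"
    by (intro has_sum_sum hs shifted_lattice_point_in_cube)
  from has_sum_cmult_right[OF this, of "1 / of_nat N"]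
  have "((\<lambda>k. 1 / of_nat N * (\<Sum>n<N. ?c k * ?e k (?x n))) has_sum complex_of_real (shifted_lattice_rule s N z \<Delta> f)) (int_vecs s)"
    by (simp add: shifted_lattice_rule_def)
  moreover have "1 / of_nat N * (\<Sum>n<N. ?c k * ?e k (?x n)) = (if int N dvd ?h k then ?c k * ?e k \<Delta> else 0)" for k
  proof -
    have "(\<Sum>n<N. ?c k * ?e k (?x n)) = (\<Sum>n<N. ?w k ^ n) * (?c k * ?e k \<Delta>)"
      unfolding fourier_char_shifted_lattice_point sum_distrib_right by (intro sum.cong) (simp_all add: mult_ac)
    thus ?thesis unfolding sum_powers_root_of_unity[OF N] using N by simp
  qed
  ultimately have "((\<lambda>k. if int N dvd ?h k then ?c k * ?e k \<Delta> else 0) has_sum complex_of_real (shifted_lattice_rule s N z \<Delta> f)) (int_vecs s)"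
    by simp
  thus ?thesis by (rule has_sum_cong_neutral[THEN iffD1, rotated -1]) auto
qed

lemma norm_sq_summable_on:
  fixes c :: "'a \<Rightarrow> 'b::real_normed_vector"
  assumes abs: "(\<lambda>k. norm (c k)) summable_on D"
  shows "(\<lambda>k. (norm (c k))\<^sup>2) summable_on D"
proof -
  let ?T = "\<Sum>\<^sub>\<infinity>k\<in>D. norm (c k)"
  have "norm (c k) * norm (c k) \<le> ?T * norm (c k)" if "k \<in> D" for k
    using finite_sum_le_infsum[OF abs, of "{k}"] that by (intro mult_right_mono) auto
  thus ?thesis
    by (intro summable_on_comparison_test[OF summable_on_cmult_right[OF abs, of ?T]]) (auto simp: power2_eq_square)
qed

text \<open>The inequality half of Parseval: exact for trigonometric polynomials by orthonormality,
  then carried to the limit by dominated convergence, since the sum of the coefficient norms bounds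
  every partial sum.\<close>

lemma integral_norm_fourier_series_le:
  fixes c :: "(nat \<Rightarrow> int) \<Rightarrow> complex"
  assumes D: "D \<subseteq> int_vecs s" and abs: "(\<lambda>k. norm (c k)) summable_on D"
    and g: "\<And>x. ((\<lambda>k. c k * fourier_char s k x) has_sum g x) D"
  shows "(LINT x:cube s|lborel_dim s. (norm (g x))\<^sup>2) \<le> (\<Sum>\<^sub>\<infinity>k\<in>D. (norm (c k))\<^sup>2)"
proof -
  let ?e = "fourier_char s"
  \<comment> \<open>Boxes exhaust \<open>D\<close> along a sequence, as dominated convergence
    requires, whereas \<open>has_sum\<close> converges along the filter of finite subsets;
    \<open>limF\<close> connects the two.\<close>
  define F where "F = (\<lambda>n::nat. {k\<in>D. \<forall>j\<in>{1..s}. \<bar>k j\<bar> \<le> int n})"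
  define gn where "gn = (\<lambda>n x. \<Sum>k\<in>F n. c k * ?e k x)"
  define T where "T = (\<Sum>\<^sub>\<infinity>k\<in>D. norm (c k))"
  have finF: "finite (F n)" for n
  proof (rule finite_subset)
    show "F n \<subseteq> {1..s} \<rightarrow>\<^sub>E {- int n..int n}"
      using D by (auto simp: F_def int_vecs_def PiE_iff abs_le_iff subset_iff) 
    show "finite ({1..s} \<rightarrow>\<^sub>E {- int n..int n})" by (intro finite_PiE) auto
  qed
  have FD: "F n \<subseteq> D" for n by (auto simp: F_def)
  have limF: "filterlim F (finite_subsets_at_top D) sequentially"
    unfolding filterlim_finite_subsets_at_top
  proof (intro allI impI)
    fix X assume X: "finite X \<and> X \<subseteq> D"
    have "\<forall>\<^sub>F n in sequentially. k \<in> F n" if "k \<in> X" for k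
    proof -
      have "\<bar>k j\<bar> \<le> int n" if n: "nat (\<Sum>j\<in>{1..s}. \<bar>k j\<bar>) \<le> n" and j: "j \<in> {1..s}" for n j
        using member_le_sum[of j "{1..s}" "\<lambda>j. \<bar>k j\<bar>"] n j by auto
      hence "k \<in> F n" if "nat (\<Sum>j\<in>{1..s}. \<bar>k j\<bar>) \<le> n" for n
        using that X \<open>k \<in> X\<close> by (auto simp: F_def)
      thus ?thesis by (auto simp: eventually_at_top_linorder)
    qed
    hence "\<forall>\<^sub>F n in sequentially. \<forall>k\<in>X. k \<in> F n"
      using X by (intro eventually_ball_finite) auto
    thus "\<forall>\<^sub>F n in sequentially. finite (F n) \<and> X \<subseteq> F n \<and> F n \<subseteq> D"
      by eventually_elim (use finF FD in auto)
  qed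
  have lim: "(\<lambda>n. gn n x) \<longlonglongrightarrow> g x" for x
    unfolding gn_def using filterlim_compose[OF g[unfolded has_sum_def] limF] .
  have gn_meas [measurable]: "gn n \<in> borel_measurable (lborel_dim s)" for n
    unfolding gn_def by measurable
  have g_meas [measurable]: "g \<in> borel_measurable (lborel_dim s)"
    by (rule borel_measurable_LIMSEQ_metric[OF gn_meas lim])
  have le_T: "(\<Sum>k\<in>X. norm (c k)) \<le> T" if "finite X" "X \<subseteq> D" for X
    unfolding T_def by (rule finite_sum_le_infsum[OF abs that]) auto
  have gT: "norm (gn n x) \<le> T" for n x
  proof -
    have "norm (gn n x) \<le> (\<Sum>k\<in>F n. norm (c k))"
      unfolding gn_def by (rule order.trans[OF norm_sum]) (simp add: norm_mult)
    also have "\<dots> \<le> T" by (rule le_T[OF finF FD])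
    finally show ?thesis .
  qed
  have sq: "(\<lambda>k. (norm (c k))\<^sup>2) summable_on D"
    by (rule norm_sq_summable_on[OF abs])
  have "(\<lambda>n. LINT x:cube s|lborel_dim s. (norm (gn n x))\<^sup>2) \<longlonglongrightarrow> (LINT x:cube s|lborel_dim s. (norm (g x))\<^sup>2)"
    unfolding set_lebesgue_integral_def
  proof (rule integral_dominated_convergence[where w = "\<lambda>x. indicator (cube s) x * T\<^sup>2"])
    show "integrable (lborel_dim s) (\<lambda>x. indicator (cube s) x * T\<^sup>2)"
      by (intro integrable_mult_left integrable_real_indicator) (simp_all add: emeasure_cube)
    show "AE x in lborel_dim s. (\<lambda>n. indicator (cube s) x *\<^sub>R (norm (gn n x))\<^sup>2) \<longlonglongrightarrow> indicator (cube s) x *\<^sub>R (norm (g x))\<^sup>2"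
      by (intro AE_I2 tendsto_intros lim)
    show "AE x in lborel_dim s. norm (indicator (cube s) x *\<^sub>R (norm (gn n x))\<^sup>2) \<le> indicator (cube s) x * T\<^sup>2" for n
      by (intro AE_I2) (auto simp: indicator_def intro!: power_mono gT)
  qed measurable
  moreover have le: "(LINT x:cube s|lborel_dim s. (norm (gn n x))\<^sup>2) \<le> (\<Sum>\<^sub>\<infinity>k\<in>D. (norm (c k))\<^sup>2)" for n
  proof -
    have "(LINT x:cube s|lborel_dim s. (norm (gn n x))\<^sup>2) = (\<Sum>k\<in>F n. (norm (c k))\<^sup>2)"
      unfolding gn_def by (rule integral_norm_trig_poly) (use finF FD D in auto)
    also have "\<dots> \<le> (\<Sum>\<^sub>\<infinity>k\<in>D. (norm (c k))\<^sup>2)"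
      by (rule finite_sum_le_infsum[OF sq finF FD]) auto
    finally show ?thesis .
  qed
  ultimately show "(LINT x:cube s|lborel_dim s. (norm (g x))\<^sup>2) \<le> (\<Sum>\<^sub>\<infinity>k\<in>D. (norm (c k))\<^sup>2)"
    by (elim LIMSEQ_le_const2) (use le in auto)
qed

lemma fourier_coeff_0: "fourier_coeff s f (\<lambda>j\<in>{1..s}. 0) = complex_of_real (LINT x:cube s|lborel_dim s. f x)"
proof -
  have "fourier_char s (\<lambda>j\<in>{1..s}. 0) x = 1" for x
    by (simp add: fourier_char_def)
  thus ?thesis unfolding fourier_coeff_def by (simp add: set_integral_complex_of_real)
qed

lemma shifted_lattice_rule_mean_square_error:
  assumes f: "f \<in> korobov_space s \<alpha> \<gamma>" and N: "N > 0"
  shows "(LINT \<Delta>:cube s|lborel_dim s. \<bar>shifted_lattice_rule s N z \<Delta> f - (LINT x:cube s|lborel_dim s. f x)\<bar>\<^sup>2)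
    \<le> (\<Sum>\<^sub>\<infinity>k\<in>dual_lattice s N z - {\<lambda>j\<in>{1..s}. 0}. (norm (fourier_coeff s f k))\<^sup>2)"
proof -
  let ?D = "dual_lattice s N z" and ?c = "fourier_coeff s f" and ?e = "fourier_char s"
  let ?o = "\<lambda>j\<in>{1..s}. 0::int"
  let ?g = "\<lambda>\<Delta>. complex_of_real (shifted_lattice_rule s N z \<Delta> f - (LINT x:cube s|lborel_dim s. f x))"
  have D: "?D = {k\<in>int_vecs s. int N dvd (\<Sum>j\<in>{1..s}. k j * int (z j))}"
    by (auto simp: dual_lattice_def cong_0_iff)
  \<comment> \<open>The zero frequency carries I(f), so removing it from the series subtracts the
    integral.\<close>
  have o: "?o \<in> ?D" by (auto simp: D int_vecs_def)
  have sub: "?D - {?o} \<subseteq> int_vecs s" by (auto simp: D)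
  have abs: "(\<lambda>k. norm (?c k)) summable_on int_vecs s" using f by (simp add: korobov_space_def)
  have g: "((\<lambda>k. ?c k * ?e k \<Delta>) has_sum ?g \<Delta>) (?D - {?o})" for \<Delta>
  proof -
    have "((\<lambda>k. ?c k * ?e k \<Delta>) has_sum complex_of_real (shifted_lattice_rule s N z \<Delta> f)) ?D"
      unfolding D by (rule shifted_lattice_rule_fourier[OF f N])
    moreover have "((\<lambda>k. ?c k * ?e k \<Delta>) has_sum complex_of_real (LINT x:cube s|lborel_dim s. f x)) {?o}"
      by (rule has_sum_finiteI) (simp_all add: fourier_coeff_0 fourier_char_def del: One_nat_def)
    ultimately show ?thesis using o by (simp add: has_sum_Diff)
  qed
  have "(LINT \<Delta>:cube s|lborel_dim s. (norm (?g \<Delta>))\<^sup>2) \<le> (\<Sum>\<^sub>\<infinity>k\<in>?D - {?o}. (norm (?c k))\<^sup>2)"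
    by (rule integral_norm_fourier_series_le[OF sub summable_on_subset_banach[OF abs sub] g])
  thus ?thesis by (simp only: norm_of_real)
qed

section \<open>The randomized algorithm\<close>

text \<open>Dividing by r^2 is legitimate even if r = 0: this happens only when some \<gamma>_j = 0
  with k_j \<noteq> 0, and there the space forces the coefficient to vanish.\<close>

lemma korobov_coeff_sq:
  assumes "f \<in> korobov_space s \<alpha> \<gamma>" "k \<in> int_vecs s"
  shows "(norm (fourier_coeff s f k))\<^sup>2 = (r_weight s \<alpha> \<gamma> k)\<^sup>2 * (norm (fourier_coeff s f k))\<^sup>2 * (1 / (r_weight s \<alpha> \<gamma> k)\<^sup>2)"
proof (cases "r_weight s \<alpha> \<gamma> k = 0")
  case True
  hence "\<exists>j\<in>{1..s}. \<gamma> j = 0 \<and> k j \<noteq> 0"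
    by (auto simp: r_weight_def)
  thus ?thesis using assms by (simp add: korobov_space_def)
qed simp

lemma freq_weight_le_coord:
  assumes c: "\<And>j. j \<ge> 1 \<Longrightarrow> 0 \<le> c j \<and> c j \<le> 1" and a: "a \<ge> 0" and j: "j \<in> {1..s}"
  shows "freq_weight a c s k \<le> coord_weight a 1 (k j)"
proof -
  have le1: "coord_weight a (c i) m \<le> 1" if "i \<ge> 1" for i m
  proof (cases "m = 0")
    case False
    hence "1 \<le> \<bar>real_of_int m\<bar> powr a" using a by (intro ge_one_powr_ge_zero) auto
    hence "c i \<le> 1 * \<bar>real_of_int m\<bar> powr a" using c[OF that] by simp
    thus ?thesis using False by (simp add: coord_weight_def divide_le_eq)
  qed (simp add: coord_weight_def)
  have "freq_weight a c s k = coord_weight a (c j) (k j) * (\<Prod>i\<in>{1..s}-{j}. coord_weight a (c i) (k i))"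
    unfolding freq_weight_def using j by (intro prod.remove) auto
  also have "\<dots> \<le> coord_weight a (c j) (k j) * 1"
    using c le1 j by (intro mult_left_mono prod_le_1) auto
  also have "\<dots> \<le> coord_weight a 1 (k j)"
    using c[of j] j by (auto simp: coord_weight_def intro!: divide_right_mono)
  finally show ?thesis .
qed

section \<open>The probability of a frequency lying in the dual lattice, and the
  interpolation\<close>

definition cbc_sum :: "nat \<Rightarrow> real \<Rightarrow> (nat \<Rightarrow> real) \<Rightarrow> real \<Rightarrow> real" where
  "cbc_sum s \<alpha> \<gamma> lam = (\<Sum>u\<in>Pow {1..s} - {{}}. (\<Prod>j\<in>u. \<gamma> j) powr (1 / lam) * (2 * riemann_zeta (\<alpha> / lam)) ^ card u)"

lemma cbc_sum_eq:
  assumes "\<And>j. j \<ge> 1 \<Longrightarrow> \<gamma> j \<ge> 0"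
  shows "cbc_sum s \<alpha> \<gamma> lam = (\<Prod>j\<in>{1..s}. 1 + \<gamma> j powr (1 / lam) * (2 * riemann_zeta (\<alpha> / lam))) - 1"
proof -
  have "(\<Prod>j\<in>u. \<gamma> j) powr (1 / lam) * (2 * riemann_zeta (\<alpha> / lam)) ^ card u
      = (\<Prod>j\<in>u. \<gamma> j powr (1 / lam) * (2 * riemann_zeta (\<alpha> / lam)))" if "u \<in> Pow {1..s} - {{}}" for u
    using that assms by (subst prod_powr_distrib) (auto simp: prod.distrib)
  thus ?thesis unfolding cbc_sum_def by (subst prod_one_plus_Pow) (auto intro: sum.cong)
qed

lemma cbc_sum_nonneg:
  assumes "1 / 2 \<le> lam" "lam < \<alpha>"
  shows "cbc_sum s \<alpha> \<gamma> lam \<ge> 0"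
  unfolding cbc_sum_def using assms riemann_zeta_nonneg[of "\<alpha> / lam"]
  by (intro sum_nonneg mult_nonneg_nonneg zero_le_power) auto

lemma R_crit_le:
  fixes N :: nat
  assumes N: "N \<in> prime_range M" and lam: "1 / 2 \<le> lam" "lam < \<alpha>" and \<gamma>: "\<And>j. j \<ge> 1 \<Longrightarrow> \<gamma> j \<ge> 0"
    and \<tau>: "0 < \<tau>" "\<tau> < 1" and z: "z \<in> cbc_vectors s \<alpha> \<gamma> N \<tau>"
  shows "R_crit s \<alpha> \<gamma> N z \<le> (2 / ((1 - \<tau>) * real M) * cbc_sum s \<alpha> \<gamma> lam) powr (2 * lam)"
proof -
  let ?R = "R_crit s \<alpha> \<gamma> N z" and ?S = "cbc_sum s \<alpha> \<gamma> lam"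
  have M: "real M > 0" using prime_rangeD(2,3)[OF N] by simp
  have "(1 - \<tau>) * (real M / 2) * ?R powr (1 / (2 * lam)) \<le> (1 - \<tau>) * (real N - 1) * ?R powr (1 / (2 * lam))"
    using \<tau> prime_rangeD(4)[OF N] by (intro mult_right_mono mult_left_mono) auto
  also have "\<dots> \<le> ?S"
    using R_crit_powr_le[OF prime_rangeD(1)[OF N] lam \<gamma> \<tau> z order.refl] cbc_sum_eq[of \<gamma> s \<alpha> lam] \<gamma>
    by simp
  finally have "?R powr (1 / (2 * lam)) * ((1 - \<tau>) * (real M / 2)) \<le> ?S" by (simp only: mult.commute)
  hence "?R powr (1 / (2 * lam)) \<le> ?S / ((1 - \<tau>) * (real M / 2))"
    using \<tau> M by (subst pos_le_divide_eq) auto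
  also have "\<dots> = 2 / ((1 - \<tau>) * real M) * ?S" by simp
  finally have "(?R powr (1 / (2 * lam))) powr (2 * lam) \<le> (2 / ((1 - \<tau>) * real M) * ?S) powr (2 * lam)"
    using lam by (intro powr_mono2) auto
  thus ?thesis using lam R_crit_nonneg[of s \<alpha> \<gamma> N z] by (simp add: powr_powr)
qed

text \<open>The probability that the random lattice has \<open>k\<close> in its dual.\<close>

definition dual_prob :: "nat \<Rightarrow> real \<Rightarrow> (nat \<Rightarrow> real) \<Rightarrow> nat \<Rightarrow> real \<Rightarrow> (nat \<Rightarrow> int) \<Rightarrow> real" where
  "dual_prob s \<alpha> \<gamma> M \<tau> k = 1 / real (card (prime_range M)) *
     (\<Sum>N\<in>prime_range M. 1 / real (card (cbc_vectors s \<alpha> \<gamma> N \<tau>)) *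
        (\<Sum>z\<in>cbc_vectors s \<alpha> \<gamma> N \<tau>. of_bool (k \<in> dual_lattice s N z)))"

text \<open>Moduli dividing k_j are counted with the trivial probability 1. For the others the
  proportion of bad vectors is at most 1/q with q = ceil (\<tau> (N - 1)) >= \<tau> M / 2.\<close>

lemma dual_prob_le:
  assumes \<tau>: "0 < \<tau>" "\<tau> < 1" and s: "s \<ge> 1" and j: "j \<in> {1..s}"
  shows "dual_prob s \<alpha> \<gamma> M \<tau> k \<le> 2 / (\<tau> * real M) +
    real (card {N\<in>prime_range M. int N dvd k j}) / real (card (prime_range M))"
proof (cases "prime_range M = {}")
  case True
  thus ?thesis using \<tau> by (simp add: dual_prob_def)
next
  case False
  let ?P = "prime_range M"
  let ?p = "\<lambda>N. 1 / real (card (cbc_vectors s \<alpha> \<gamma> N \<tau>)) *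
        (\<Sum>z\<in>cbc_vectors s \<alpha> \<gamma> N \<tau>. of_bool (k \<in> dual_lattice s N z) :: real)"
  have P: "real (card ?P) > 0" using False by (simp add: card_gt_0_iff)
  have "?p N \<le> 2 / (\<tau> * real M) + of_bool (int N dvd k j)" if N: "N \<in> ?P" for N
  proof -
    let ?Z = "cbc_vectors s \<alpha> \<gamma> N \<tau>"
    let ?D = "{z\<in>?Z. int N dvd (\<Sum>i\<in>{1..s}. k i * int (z i))}"
    have "(\<Sum>z\<in>?Z. of_bool (k \<in> dual_lattice s N z) :: real) \<le> (\<Sum>z\<in>?Z. of_bool (int N dvd (\<Sum>i\<in>{1..s}. k i * int (z i))))"
      by (intro sum_mono) (auto simp: mem_dual_lattice_iff)
    also have "\<dots> = real (card ?D)"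
      by (simp add: Int_def)
    finally have "?p N \<le> 1 / real (card ?Z) * real (card ?D)"
      by (intro mult_left_mono) auto
    also have "\<dots> = real (card ?D) / real (card ?Z)" by simp
    finally have p: "?p N \<le> real (card ?D) / real (card ?Z)" .
    have M: "real M > 0" using prime_rangeD(2,3)[OF N] by simp
    show ?thesis
    proof (cases "int N dvd k j")
      case True
      have "real (card ?D) \<le> real (card ?Z)" unfolding of_nat_le_iff by (intro card_mono) auto
      hence "real (card ?D) / real (card ?Z) \<le> 1" by (cases "card ?Z = 0") (auto simp: divide_le_eq_1 card_gt_0_iff)
      with p have "?p N \<le> 1" by (rule order.trans)
      also have "\<dots> \<le> 2 / (\<tau> * real M) + of_bool (int N dvd k j)" using True \<tau> by simp
      finally show ?thesis .
    next
      case F: False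
      define q where "q = nat \<lceil>\<tau> * (real N - 1)\<rceil>"
      have "card ?D * q \<le> card ?Z"
        unfolding q_def by (rule card_cbc_vectors_dual_le[where j = j and k = k, OF prime_rangeD(1)[OF N] \<tau> s j F])
      hence "real (card ?D) * real q \<le> real (card ?Z)" by (simp flip: of_nat_mult)
      moreover have "\<tau> * (real M / 2) \<le> \<tau> * (real N - 1)"
        using prime_rangeD(4)[OF N] \<tau> by (intro mult_left_mono) auto
      hence "\<tau> * (real M / 2) \<le> real q"
        using cbc_candidates_count_le(2)[OF \<tau> prime_rangeD(2)[OF N]] by (simp add: q_def)
      hence "real (card ?D) * (\<tau> * (real M / 2)) \<le> real (card ?D) * real q"
        by (intro mult_left_mono) auto
      ultimately have "real (card ?D) * (\<tau> * (real M / 2)) \<le> real (card ?Z)" by linarith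
      hence "real (card ?D) / real (card ?Z) \<le> 2 / (\<tau> * real M)"
        using \<tau> M by (cases "card ?Z = 0") (auto simp: field_simps card_gt_0_iff)
      with p have "?p N \<le> 2 / (\<tau> * real M)" by (rule order.trans)
      also have "\<dots> = 2 / (\<tau> * real M) + of_bool (int N dvd k j)" using F by simp
      finally show ?thesis .
    qed
  qed
  hence "(\<Sum>N\<in>?P. ?p N) \<le> (\<Sum>N\<in>?P. 2 / (\<tau> * real M) + of_bool (int N dvd k j))"
    by (rule sum_mono)
  also have "\<dots> = real (card ?P) * (2 / (\<tau> * real M)) + real (card {N\<in>?P. int N dvd k j})"
    by (simp add: sum.distrib Int_def)
  finally have "1 / real (card ?P) * (\<Sum>N\<in>?P. ?p N)
      \<le> 1 / real (card ?P) * (real (card ?P) * (2 / (\<tau> * real M)) + real (card {N\<in>?P. int N dvd k j}))"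
    by (intro mult_left_mono) auto
  also have "\<dots> = 2 / (\<tau> * real M) + real (card {N\<in>?P. int N dvd k j}) / real (card ?P)"
    using False by (simp add: distrib_left)
  finally show ?thesis by (simp only: dual_prob_def)
qed

lemma weighted_dual_prob_le:
  fixes \<alpha> :: real and \<gamma> :: "nat \<Rightarrow> real"
  assumes lam: "1 / 2 \<le> lam" "lam < \<alpha>" and \<gamma>: "\<And>j. j \<ge> 1 \<Longrightarrow> 0 \<le> \<gamma> j \<and> \<gamma> j \<le> 1"
    and \<delta>: "0 < \<delta>" "\<delta> < 1"
  shows "\<exists>C>0. \<forall>s M \<tau>. \<forall>k\<in>int_vecs s - {\<lambda>j\<in>{1..s}. 0}. s \<ge> 1 \<and> M \<ge> 2 \<and> 0 < \<tau> \<and> \<tau> < 1 \<longrightarrow>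
       1 / (r_weight s \<alpha> \<gamma> k)\<^sup>2 * dual_prob s \<alpha> \<gamma> M \<tau> k \<le>
         C / (\<delta> * \<tau> * real M) *
         (2 / ((1 - \<tau>) * real M) * cbc_sum s \<alpha> \<gamma> lam) powr (2 * (lam * (1 - \<delta> / (2 * \<alpha>))))"
proof -
  obtain C where C: "C > 0" "\<And>M k. k \<noteq> (0::int) \<Longrightarrow>
      real (card {N\<in>prime_range M. int N dvd k}) / real (card (prime_range M))
        \<le> C * \<bar>real_of_int k\<bar> powr \<delta> / real M"
    using prime_range_dvd_proportion[OF \<delta>] by blast
  show ?thesis
  \<comment> \<open>In 2 + C, the 2 belongs to the moduli not dividing k_j and C to those that
    do.\<close>
  proof (intro exI[of _ "2 + C"] conjI allI ballI impI)
    show "2 + C > 0" using C by simp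
    fix s M :: nat and \<tau> :: real and k :: "nat \<Rightarrow> int"
    assume k: "k \<in> int_vecs s - {\<lambda>j\<in>{1..s}. 0}" and "s \<ge> 1 \<and> M \<ge> 2 \<and> 0 < \<tau> \<and> \<tau> < 1"
    hence s: "s \<ge> 1" and M: "M \<ge> 2" and \<tau>: "0 < \<tau>" "\<tau> < 1" by auto
    define w where "w = 1 / (r_weight s \<alpha> \<gamma> k)\<^sup>2"
    define B where "B = (2 / ((1 - \<tau>) * real M) * cbc_sum s \<alpha> \<gamma> lam) powr (2 * lam)"
    define p where "p = dual_prob s \<alpha> \<gamma> M \<tau> k"
    define e where "e = 1 - \<delta> / (2 * \<alpha>)"
    have \<alpha>: "\<alpha> > 1 / 2" using lam by simp
    have e: "0 < e" "e < 1" using \<alpha> \<delta> by (auto simp: e_def field_simps)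
    have w_eq: "w = freq_weight (2 * \<alpha>) (\<lambda>j. (\<gamma> j)\<^sup>2) s k"
      by (simp add: w_def inverse_r_weight_sq)
    have w0: "w \<ge> 0" by (simp add: w_def)
    have p0: "p \<ge> 0" unfolding p_def dual_prob_def by (intro mult_nonneg_nonneg sum_nonneg) auto
    have B: "B powr e = (2 / ((1 - \<tau>) * real M) * cbc_sum s \<alpha> \<gamma> lam) powr (2 * (lam * (1 - \<delta> / (2 * \<alpha>))))"
      by (simp add: B_def powr_powr e_def mult.assoc)
    have K0: "0 \<le> (2 + C) / (\<delta> * \<tau> * real M) * B powr e" using C \<delta> \<tau> by simp
    have "w * p \<le> (2 + C) / (\<delta> * \<tau> * real M) * B powr e"
    \<comment> \<open>The bound w <= B comes from an actual lattice whose dual contains k, and p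
      \<noteq> 0 provides one.\<close>
    proof (cases "p = 0 \<or> w = 0")
      case True
      thus ?thesis using K0 by auto
    next
      case False
      have "\<exists>N\<in>prime_range M. \<exists>z\<in>cbc_vectors s \<alpha> \<gamma> N \<tau>. k \<in> dual_lattice s N z"
      proof (rule ccontr)
        assume "\<not> ?thesis"
        hence "p = 0" unfolding p_def dual_prob_def by simp
        thus False using False by simp
      qed
      then obtain N z where N: "N \<in> prime_range M" and z: "z \<in> cbc_vectors s \<alpha> \<gamma> N \<tau>" and kd: "k \<in> dual_lattice s N z"
        by blast
      have "(\<Sum>k\<in>{k}. 1 / (r_weight s \<alpha> \<gamma> k)\<^sup>2) \<le> R_crit s \<alpha> \<gamma> N z"
        unfolding R_crit_def
      proof (rule finite_sum_le_infsum)
        show "(\<lambda>k. 1 / (r_weight s \<alpha> \<gamma> k)\<^sup>2) summable_on dual_lattice s N z - {\<lambda>j\<in>{1..s}. 0}"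
          unfolding inverse_r_weight_sq
          by (rule freq_weight_summable_on) (use \<alpha> in \<open>auto simp: mem_dual_lattice_iff\<close>)
      qed (use kd k in auto)
      hence "w \<le> R_crit s \<alpha> \<gamma> N z" by (simp add: w_def)
      also have "\<dots> \<le> B" unfolding B_def by (rule R_crit_le[OF N lam _ \<tau> z]) (use \<gamma> in auto)
      finally have wB: "w \<le> B" .
      obtain j where j: "j \<in> {1..s}" "k j \<noteq> 0"
      proof -
        have "\<exists>j\<in>{1..s}. k j \<noteq> 0"
        proof (rule ccontr)
          assume "\<not> ?thesis"
          hence "k = (\<lambda>j\<in>{1..s}. 0)" using k
            by (auto simp: int_vecs_def PiE_def extensional_def restrict_def fun_eq_iff)
          thus False using k by blast
        qed
        thus thesis using that by blast
      qed
      define x where "x = \<bar>real_of_int (k j)\<bar>"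
      have x1: "x \<ge> 1" using j by (simp add: x_def)
      have "w \<le> coord_weight (2 * \<alpha>) 1 (k j)"
        unfolding w_eq by (rule freq_weight_le_coord) (use \<gamma> \<alpha> j in \<open>auto simp: power_le_one\<close>)
      hence "w \<le> x powr (- (2 * \<alpha>))" using j by (simp add: coord_weight_def x_def powr_minus_divide)
      hence "w powr (\<delta> / (2 * \<alpha>)) \<le> (x powr (- (2 * \<alpha>))) powr (\<delta> / (2 * \<alpha>))"
        using w0 \<alpha> \<delta> by (intro powr_mono2) auto
      hence wx: "w powr (\<delta> / (2 * \<alpha>)) \<le> x powr (- \<delta>)" using \<alpha> by (simp add: powr_powr)
      \<comment> \<open>The two factors of the interpolation: the first meets \<open>wB\<close>, the
        second \<open>wx\<close>.\<close>
      have w_split: "w = w powr e * w powr (\<delta> / (2 * \<alpha>))"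
        using w0 by (simp add: e_def flip: powr_add)
      have "p \<le> 2 / (\<tau> * real M) + C * x powr \<delta> / real M"
        using dual_prob_le[OF \<tau> s j(1), of \<alpha> \<gamma> M k] C(2)[OF j(2), of M] by (simp add: p_def x_def)
      hence "w powr (\<delta> / (2 * \<alpha>)) * p \<le> x powr (- \<delta>) * (2 / (\<tau> * real M) + C * x powr \<delta> / real M)"
        using wx p0 by (intro mult_mono) auto
      also have "\<dots> = x powr (- \<delta>) * (2 / (\<tau> * real M)) + C / real M * (x powr (- \<delta>) * x powr \<delta>)"
        by (simp add: algebra_simps)
      also have "x powr (- \<delta>) * x powr \<delta> = 1" using x1 by (simp flip: powr_add)
      also have "x powr (- \<delta>) * (2 / (\<tau> * real M)) \<le> 1 * (2 / (\<tau> * real M))"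
        using x1 \<delta> \<tau> by (intro mult_right_mono) (auto simp: powr_minus_divide ge_one_powr_ge_zero)
      also have "1 * (2 / (\<tau> * real M)) + C / real M * 1 \<le> (2 + C) / (\<tau> * real M)"
      proof -
        have "C / real M \<le> C / (\<tau> * real M)"
          using C \<tau> M by (intro divide_left_mono) auto
        thus ?thesis by (simp add: add_divide_distrib)
      qed
      \<comment> \<open>Inserting 1/\<delta> > 1 weakens the bound to the shape c' / (\<delta>
        \<tau> M); the dependence of C on \<delta> remains inside c'.\<close>
      also have "\<dots> \<le> (2 + C) / (\<delta> * (\<tau> * real M))"
        using C \<tau> \<delta> M by (intro divide_left_mono) (auto simp: mult_le_cancel_right1)
      finally have wp: "w powr (\<delta> / (2 * \<alpha>)) * p \<le> (2 + C) / (\<delta> * \<tau> * real M)"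
        by (simp only: mult.assoc)
      have "w * p = w powr e * (w powr (\<delta> / (2 * \<alpha>)) * p)"
        by (subst w_split) (simp only: mult.assoc)
      also have "\<dots> \<le> B powr e * ((2 + C) / (\<delta> * \<tau> * real M))"
        using wB w0 e p0 wp by (intro mult_mono powr_mono2) auto
      finally show ?thesis by (simp only: mult.commute)
    qed
    thus "1 / (r_weight s \<alpha> \<gamma> k)\<^sup>2 * dual_prob s \<alpha> \<gamma> M \<tau> k \<le>
         (2 + C) / (\<delta> * \<tau> * real M) *
         (2 / ((1 - \<tau>) * real M) * cbc_sum s \<alpha> \<gamma> lam) powr (2 * (lam * (1 - \<delta> / (2 * \<alpha>))))"
      by (simp only: B w_def p_def)
  qed
qed

lemma rms_error_le:
  fixes s M :: nat
  assumes K: "\<And>k. k \<in> int_vecs s - {\<lambda>j\<in>{1..s}. 0} \<Longrightarrow>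
      1 / (r_weight s \<alpha> \<gamma> k)\<^sup>2 * dual_prob s \<alpha> \<gamma> M \<tau> k \<le> K" and K0: "K \<ge> 0"
  shows "rms_error s \<alpha> \<gamma> M \<tau> \<le> ereal (sqrt K)"
  unfolding rms_error_def
proof (rule SUP_least)
  fix f assume f: "f \<in> {f \<in> korobov_space s \<alpha> \<gamma>. korobov_norm s \<alpha> \<gamma> f \<le> 1}"
  let ?P = "prime_range M" and ?Z = "\<lambda>N. cbc_vectors s \<alpha> \<gamma> N \<tau>"
  let ?c = "\<lambda>k. (norm (fourier_coeff s f k))\<^sup>2"
  let ?a = "\<lambda>k. (r_weight s \<alpha> \<gamma> k)\<^sup>2 * ?c k"
  let ?I = "\<lambda>N z. LINT \<Delta>:cube s|lborel_dim s.
      \<bar>shifted_lattice_rule s N z \<Delta> f - (LINT x:cube s|lborel_dim s. f x)\<bar>\<^sup>2"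
  let ?Y = "int_vecs s - {\<lambda>j\<in>{1..s}. 0::int}"
  have fk: "f \<in> korobov_space s \<alpha> \<gamma>" using f by simp
  have as: "?a summable_on int_vecs s" using fk by (simp add: korobov_space_def)
  have a1: "(\<Sum>\<^sub>\<infinity>k\<in>int_vecs s. ?a k) \<le> 1"
    using f by (simp add: korobov_norm_def)
  have asY: "?a summable_on ?Y" by (rule summable_on_subset_banach[OF as]) auto
  have cs: "?c summable_on int_vecs s"
    using fk by (intro norm_sq_summable_on) (simp add: korobov_space_def)
  have csY: "?c summable_on ?Y" by (rule summable_on_subset_banach[OF cs]) auto
  have I: "?I N z \<le> (\<Sum>\<^sub>\<infinity>k\<in>?Y. of_bool (k \<in> dual_lattice s N z) * ?c k)" if "N \<in> ?P" for N z
  proof -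
    have "?I N z \<le> (\<Sum>\<^sub>\<infinity>k\<in>dual_lattice s N z - {\<lambda>j\<in>{1..s}. 0}. ?c k)"
      using prime_rangeD(2)[OF that] by (intro shifted_lattice_rule_mean_square_error[OF fk]) simp
    \<comment> \<open>An indicator extends the sum to all nonzero frequencies, one index set for all
      N and z, so that the finite averages pass under the infinite sum.\<close>
    also have "\<dots> = (\<Sum>\<^sub>\<infinity>k\<in>?Y. of_bool (k \<in> dual_lattice s N z) * ?c k)"
      by (intro infsum_cong_neutral) (auto simp: mem_dual_lattice_iff)
    finally show ?thesis .
  qed
  have bs: "(\<lambda>k. of_bool (k \<in> dual_lattice s N z) * ?c k) summable_on ?Y" for N z
    by (rule summable_on_comparison_test[OF csY]) (auto simp: of_bool_def)
  have "1 / real (card ?P) * (\<Sum>N\<in>?P. 1 / real (card (?Z N)) * (\<Sum>z\<in>?Z N. ?I N z))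
      \<le> 1 / real (card ?P) * (\<Sum>N\<in>?P. 1 / real (card (?Z N)) *
          (\<Sum>z\<in>?Z N. \<Sum>\<^sub>\<infinity>k\<in>?Y. of_bool (k \<in> dual_lattice s N z) * ?c k))"
    by (intro mult_left_mono sum_mono I) auto
  also have "\<dots> = (\<Sum>\<^sub>\<infinity>k\<in>?Y. 1 / real (card ?P) * (\<Sum>N\<in>?P. 1 / real (card (?Z N)) *
          (\<Sum>z\<in>?Z N. of_bool (k \<in> dual_lattice s N z) * ?c k)))"
    by (intro infsumI[symmetric] has_sum_cmult_right has_sum_sum has_sum_infsum bs)
  also have "\<dots> = (\<Sum>\<^sub>\<infinity>k\<in>?Y. dual_prob s \<alpha> \<gamma> M \<tau> k * ?c k)"
    by (simp add: dual_prob_def sum_distrib_right sum_distrib_left sum_divide_distrib mult.assoc)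
  also have "\<dots> \<le> (\<Sum>\<^sub>\<infinity>k\<in>?Y. K * ?a k)"
  proof (rule infsum_mono)
    have "((\<lambda>k. 1 / real (card ?P) * (\<Sum>N\<in>?P. 1 / real (card (?Z N)) *
          (\<Sum>z\<in>?Z N. of_bool (k \<in> dual_lattice s N z) * ?c k)))
        has_sum (1 / real (card ?P) * (\<Sum>N\<in>?P. 1 / real (card (?Z N)) *
          (\<Sum>z\<in>?Z N. \<Sum>\<^sub>\<infinity>k\<in>?Y. of_bool (k \<in> dual_lattice s N z) * ?c k)))) ?Y"
      by (intro has_sum_cmult_right has_sum_sum has_sum_infsum bs)
    thus "(\<lambda>k. dual_prob s \<alpha> \<gamma> M \<tau> k * ?c k) summable_on ?Y"
      by (auto simp: summable_on_def dual_prob_def sum_distrib_right sum_distrib_left sum_divide_distrib mult.assoc)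
    show "(\<lambda>k. K * ?a k) summable_on ?Y" by (intro summable_on_cmult_right asY)
    fix k assume k: "k \<in> ?Y"
    have "?c k = ?a k * (1 / (r_weight s \<alpha> \<gamma> k)\<^sup>2)"
      by (rule korobov_coeff_sq[OF fk]) (use k in simp)
    hence "dual_prob s \<alpha> \<gamma> M \<tau> k * ?c k = dual_prob s \<alpha> \<gamma> M \<tau> k * (?a k * (1 / (r_weight s \<alpha> \<gamma> k)\<^sup>2))"
      by (rule arg_cong)
    also have "\<dots> = ?a k * (1 / (r_weight s \<alpha> \<gamma> k)\<^sup>2 * dual_prob s \<alpha> \<gamma> M \<tau> k)"
      by (simp only: mult_ac)
    also have "\<dots> \<le> ?a k * K" by (intro mult_left_mono K k) auto
    finally show "dual_prob s \<alpha> \<gamma> M \<tau> k * ?c k \<le> K * ?a k" by (simp only: mult.commute)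
  qed
  also have "\<dots> = K * (\<Sum>\<^sub>\<infinity>k\<in>?Y. ?a k)" using asY by (rule infsum_cmult_right)
  also have "\<dots> \<le> K * (\<Sum>\<^sub>\<infinity>k\<in>int_vecs s. ?a k)"
    by (intro mult_left_mono K0 infsum_mono2 asY as) auto
  also have "\<dots> \<le> K * 1" by (intro mult_left_mono a1 K0)
  finally show "ereal (sqrt (1 / real (card ?P) * (\<Sum>N\<in>?P. 1 / real (card (?Z N)) * (\<Sum>z\<in>?Z N. ?I N z)))) \<le> ereal (sqrt K)"
    by simp
qed

text \<open>By 1 + x <= exp x the product over coordinates is at most the exponential of a sum, and
  the partial sums of the weight series are bounded by its total, which is free of s.\<close>

lemma cbc_sum_le_exp:
  assumes lam: "1 / 2 \<le> lam" "lam < \<alpha>" and \<gamma>: "\<And>j. j \<ge> 1 \<Longrightarrow> \<gamma> j \<ge> 0"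
    and sm: "summable (\<lambda>j. \<gamma> (Suc j) powr (1 / lam))"
  shows "cbc_sum s \<alpha> \<gamma> lam \<le> exp ((\<Sum>j. \<gamma> (Suc j) powr (1 / lam)) * (2 * riemann_zeta (\<alpha> / lam)))"
proof -
  let ?z = "2 * riemann_zeta (\<alpha> / lam)"
  have z: "?z \<ge> 0" using lam riemann_zeta_nonneg[of "\<alpha> / lam"] by simp
  have "cbc_sum s \<alpha> \<gamma> lam \<le> (\<Prod>j\<in>{1..s}. 1 + \<gamma> j powr (1 / lam) * ?z)"
    by (subst cbc_sum_eq[OF \<gamma>]) auto
  also have "\<dots> \<le> (\<Prod>j\<in>{1..s}. exp (\<gamma> j powr (1 / lam) * ?z))"
    using z by (intro prod_mono conjI exp_ge_add_one_self add_nonneg_nonneg mult_nonneg_nonneg) auto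
  also have "\<dots> = exp ((\<Sum>j\<in>{1..s}. \<gamma> j powr (1 / lam)) * ?z)"
    by (simp only: exp_sum sum_distrib_right finite_atLeastAtMost)
  also have "(\<Sum>j\<in>{1..s}. \<gamma> j powr (1 / lam)) = (\<Sum>j<s. \<gamma> (Suc j) powr (1 / lam))"
    by (rule sum.reindex_bij_witness[of _ Suc "\<lambda>j. j - 1"]) auto
  also have "exp (\<dots> * ?z) \<le> exp ((\<Sum>j. \<gamma> (Suc j) powr (1 / lam)) * ?z)"
    unfolding exp_le_cancel_iff using z sm by (intro mult_right_mono sum_le_suminf) auto
  finally show ?thesis .
qed

section \<open>Limit of the convergence rate and assembly of the error bound\<close>

lemma tendsto_convergence_rate:
  fixes \<alpha> :: real
  assumes "\<alpha> \<noteq> 0"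
  shows "((\<lambda>(lam, \<delta>). 1 / 2 + lam * (1 - \<delta> / (2 * \<alpha>))) \<longlongrightarrow> \<alpha> + 1 / 2) (at_left \<alpha> \<times>\<^sub>F at_right 0)"
proof -
  have 1: "(fst \<longlongrightarrow> \<alpha>) (at_left \<alpha> \<times>\<^sub>F at_right (0::real))"
    by (rule filterlim_compose[OF tendsto_ident_at filterlim_fst])
  have 2: "(snd \<longlongrightarrow> 0) (at_left \<alpha> \<times>\<^sub>F at_right (0::real))"
    by (rule filterlim_compose[OF tendsto_ident_at filterlim_snd])
  have "((\<lambda>p. 1 / 2 + fst p * (1 - snd p / (2 * \<alpha>))) \<longlongrightarrow> 1 / 2 + \<alpha> * (1 - 0 / (2 * \<alpha>))) (at_left \<alpha> \<times>\<^sub>F at_right 0)"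
    by (intro tendsto_intros 1 2) (use assms in auto)
  thus ?thesis by (simp add: case_prod_unfold add.commute)
qed

lemma rms_error_bound:
  fixes \<alpha> :: real and \<gamma> :: "nat \<Rightarrow> real"
  assumes lam: "1 / 2 \<le> lam" "lam < \<alpha>" and \<gamma>: "\<And>j. j \<ge> 1 \<Longrightarrow> 0 \<le> \<gamma> j \<and> \<gamma> j \<le> 1"
    and \<delta>: "0 < \<delta>" "\<delta> < 1"
  shows "\<exists>C>0. \<forall>s M \<tau>. s \<ge> 1 \<and> M \<ge> 2 \<and> 0 < \<tau> \<and> \<tau> < 1 \<longrightarrow>
    rms_error s \<alpha> \<gamma> M \<tau> \<le> ereal (sqrt (C / (\<delta> * \<tau> * real M)) *
      (2 / ((1 - \<tau>) * real M) * cbc_sum s \<alpha> \<gamma> lam) powr (lam * (1 - \<delta> / (2 * \<alpha>))))"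
proof -
  define e where "e = lam * (1 - \<delta> / (2 * \<alpha>))"
  obtain C where C: "C > 0" and bound: "\<forall>s M \<tau>. \<forall>k\<in>int_vecs s - {\<lambda>j\<in>{1..s}. 0}.
       s \<ge> 1 \<and> M \<ge> 2 \<and> 0 < \<tau> \<and> \<tau> < 1 \<longrightarrow>
       1 / (r_weight s \<alpha> \<gamma> k)\<^sup>2 * dual_prob s \<alpha> \<gamma> M \<tau> k \<le>
         C / (\<delta> * \<tau> * real M) * (2 / ((1 - \<tau>) * real M) * cbc_sum s \<alpha> \<gamma> lam) powr (2 * e)"
    using weighted_dual_prob_le[OF lam _ \<delta>, of \<gamma>] \<gamma> unfolding e_def by blast
  have "rms_error s \<alpha> \<gamma> M \<tau> \<le> ereal (sqrt (C / (\<delta> * \<tau> * real M)) *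
      (2 / ((1 - \<tau>) * real M) * cbc_sum s \<alpha> \<gamma> lam) powr e)"
    if "s \<ge> 1 \<and> M \<ge> 2 \<and> 0 < \<tau> \<and> \<tau> < 1" for s M :: nat and \<tau> :: real
  proof -
    let ?A = "C / (\<delta> * \<tau> * real M)" and ?X = "2 / ((1 - \<tau>) * real M) * cbc_sum s \<alpha> \<gamma> lam"
    have A: "?A \<ge> 0" using C \<delta> that by simp
    have "rms_error s \<alpha> \<gamma> M \<tau> \<le> ereal (sqrt (?A * ?X powr (2 * e)))"
    proof (rule rms_error_le)
      show "0 \<le> ?A * ?X powr (2 * e)" by (intro mult_nonneg_nonneg A) auto
    qed (use bound that in blast)
    \<comment> \<open>The bound on the squared error carries the doubled exponent; the square root
      halves it.\<close>
    also have "?X powr (2 * e) = (?X powr e)\<^sup>2"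
      by (simp add: power2_eq_square flip: powr_add)
    also have "sqrt (?A * (?X powr e)\<^sup>2) = sqrt ?A * ?X powr e"
      unfolding real_sqrt_mult by simp
    finally show ?thesis .
  qed
  thus ?thesis using C unfolding e_def by blast
qed

theorem mainTheorem3:
  fixes \<alpha> :: real and \<gamma> :: "nat \<Rightarrow> real"
  assumes "\<alpha> > 1 / 2"
    and "\<And>j. j \<ge> 1 \<Longrightarrow> 0 \<le> \<gamma> j \<and> \<gamma> j \<le> 1"
  shows
    "(\<forall>lam \<delta> :: real. 1 / 2 \<le> lam \<and> lam < \<alpha> \<and> 0 < \<delta> \<and> \<delta> < 1 \<longrightarrow>
       (\<exists>c' :: real. c' > 0 \<and>
          (\<forall>(s::nat) (M::nat) (\<tau>::real). s \<ge> 1 \<and> M \<ge> 2 \<and> 0 < \<tau> \<and> \<tau> < 1 \<longrightarrow>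
             rms_error s \<alpha> \<gamma> M \<tau> \<le> ereal (
               sqrt (c' / (\<delta> * \<tau> * real M)) *
               (2 / ((1 - \<tau>) * real M) *
                 (\<Sum>u\<in>Pow {1..s} - {{}}.
                    (\<Prod>j\<in>u. \<gamma> j) powr (1 / lam) * (2 * riemann_zeta (\<alpha> / lam)) ^ card u))
               powr (lam * (1 - \<delta> / (2 * \<alpha>))))) \<and>
          (summable (\<lambda>j. \<gamma> (Suc j) powr (1 / lam)) \<longrightarrow>
             (\<exists>B :: real. B \<ge> 0 \<and>
               (\<forall>(s::nat) (M::nat) (\<tau>::real). s \<ge> 1 \<and> M \<ge> 2 \<and> 0 < \<tau> \<and> \<tau> < 1 \<longrightarrow>
                  rms_error s \<alpha> \<gamma> M \<tau> \<le> ereal (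
                    sqrt (c' / (\<delta> * \<tau> * real M)) *
                    (2 / ((1 - \<tau>) * real M) * B) powr (lam * (1 - \<delta> / (2 * \<alpha>)))))))) \<and>
       (\<forall>(s::nat) (\<tau>::real). s \<ge> 1 \<and> 0 < \<tau> \<and> \<tau> < 1 \<longrightarrow>
          (\<exists>C :: real. \<forall>M::nat. M \<ge> 2 \<longrightarrow>
             rms_error s \<alpha> \<gamma> M \<tau> \<le>
               ereal (C / real M powr (1 / 2 + lam * (1 - \<delta> / (2 * \<alpha>))))))) \<and>
     ((\<lambda>(lam, \<delta>). 1 / 2 + lam * (1 - \<delta> / (2 * \<alpha>))) \<longlongrightarrow> \<alpha> + 1 / 2)
       (at_left \<alpha> \<times>\<^sub>F at_right 0)"
proof (rule conjI, intro allI impI, goal_cases)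
  case (1 lam \<delta>)
  hence lam: "1 / 2 \<le> lam" "lam < \<alpha>" and \<delta>: "0 < \<delta>" "\<delta> < 1" by auto
  have \<gamma>0: "\<And>j. j \<ge> 1 \<Longrightarrow> \<gamma> j \<ge> 0" using assms(2) by blast
  define e where "e = lam * (1 - \<delta> / (2 * \<alpha>))"
  have e: "e > 0" unfolding e_def using lam \<delta> by (auto intro!: mult_pos_pos simp: field_simps)
  obtain C where C: "C > 0" and bound: "\<And>s M \<tau>. s \<ge> 1 \<and> M \<ge> 2 \<and> 0 < \<tau> \<and> \<tau> < 1 \<Longrightarrow>
    rms_error s \<alpha> \<gamma> M \<tau> \<le> ereal (sqrt (C / (\<delta> * \<tau> * real M)) *
      (2 / ((1 - \<tau>) * real M) * cbc_sum s \<alpha> \<gamma> lam) powr e)"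
    using rms_error_bound[OF lam _ \<delta>, of \<gamma>] assms(2) unfolding e_def by blast
  have uniform: "\<exists>B :: real. B \<ge> 0 \<and>
      (\<forall>(s::nat) (M::nat) (\<tau>::real). s \<ge> 1 \<and> M \<ge> 2 \<and> 0 < \<tau> \<and> \<tau> < 1 \<longrightarrow>
         rms_error s \<alpha> \<gamma> M \<tau> \<le> ereal (sqrt (C / (\<delta> * \<tau> * real M)) * (2 / ((1 - \<tau>) * real M) * B) powr e))"
    if sm: "summable (\<lambda>j. \<gamma> (Suc j) powr (1 / lam))"
  proof -
    define B where "B = exp ((\<Sum>j. \<gamma> (Suc j) powr (1 / lam)) * (2 * riemann_zeta (\<alpha> / lam)))"
    show ?thesis
    proof (intro exI[of _ B] conjI allI impI)
      show "B \<ge> 0" by (simp add: B_def)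
      fix s M :: nat and \<tau> :: real assume h: "s \<ge> 1 \<and> M \<ge> 2 \<and> 0 < \<tau> \<and> \<tau> < 1"
      have S: "0 \<le> cbc_sum s \<alpha> \<gamma> lam" "cbc_sum s \<alpha> \<gamma> lam \<le> B"
        unfolding B_def by (rule cbc_sum_nonneg[OF lam], rule cbc_sum_le_exp[OF lam \<gamma>0 sm])
      note bound[OF h]
      also have "ereal (sqrt (C / (\<delta> * \<tau> * real M)) * (2 / ((1 - \<tau>) * real M) * cbc_sum s \<alpha> \<gamma> lam) powr e)
          \<le> ereal (sqrt (C / (\<delta> * \<tau> * real M)) * (2 / ((1 - \<tau>) * real M) * B) powr e)"
        unfolding ereal_less_eq using h e C \<delta> S
        by (intro mult_left_mono powr_mono2 mult_nonneg_nonneg) auto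
      finally show "rms_error s \<alpha> \<gamma> M \<tau>
          \<le> ereal (sqrt (C / (\<delta> * \<tau> * real M)) * (2 / ((1 - \<tau>) * real M) * B) powr e)" .
    qed
  qed
  have rate: "\<exists>C :: real. \<forall>M::nat. M \<ge> 2 \<longrightarrow> rms_error s \<alpha> \<gamma> M \<tau> \<le> ereal (C / real M powr (1 / 2 + e))"
    if h: "s \<ge> 1 \<and> 0 < \<tau> \<and> \<tau> < 1" for s :: nat and \<tau> :: real
  \<comment> \<open>The witness stays schematic until the last claim fixes it as \<open>sqrt (C /
    (\<delta> * \<tau>)) * (2 / (1 - \<tau>) * ?S) powr e\<close>, which does not involve
    \<open>M\<close>.\<close>
  proof (intro exI allI impI)
    let ?S = "cbc_sum s \<alpha> \<gamma> lam"
    fix M :: nat assume M: "M \<ge> 2"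
    have "sqrt (C / (\<delta> * \<tau> * real M)) = sqrt (C / (\<delta> * \<tau>)) / real M powr (1 / 2)"
      by (simp add: powr_half_sqrt real_sqrt_divide real_sqrt_mult)
    moreover have "(2 / ((1 - \<tau>) * real M) * ?S) powr e = (2 / (1 - \<tau>) * ?S / real M) powr e"
      by simp
    moreover have "\<dots> = (2 / (1 - \<tau>) * ?S) powr e / real M powr e"
      by (rule powr_divide)
    ultimately have "sqrt (C / (\<delta> * \<tau> * real M)) * (2 / ((1 - \<tau>) * real M) * ?S) powr e
        = sqrt (C / (\<delta> * \<tau>)) * (2 / (1 - \<tau>) * ?S) powr e / real M powr (1 / 2 + e)"
      by (simp add: powr_add)
    thus "rms_error s \<alpha> \<gamma> M \<tau>
        \<le> ereal (sqrt (C / (\<delta> * \<tau>)) * (2 / (1 - \<tau>) * ?S) powr e / real M powr (1 / 2 + e))"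
      using bound[of s M \<tau>] h M by simp
  qed
  \<comment> \<open>The same \<open>C\<close> serves as c' in the bound and in its
    dimension-independent form.\<close>
  show ?case
    unfolding cbc_sum_def[symmetric] e_def[symmetric]
    by (rule conjI, rule exI[of _ C], intro conjI)
       (rule C, intro allI impI, erule bound, rule impI, erule uniform, intro allI impI, erule rate)
next
  case 2
  show ?case by (rule tendsto_convergence_rate) (use assms in simp)
qed

end
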